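(* Let $b>0$, $c>1$, $m>-1/2$ and let $X$ have the McKay Type I distribution with parameters $m,b,c$. Then the distribution of $X$ is unimodal. Let $M$ denote its mode. If $-1/2<m\leq0$, then $M=0$. If $m>0$, then $$\frac{(2m-1)bc}{c^2-1}<M<\frac{bc}{c^2-1}\Big[m-\tfrac12+\sqrt{(m+\tfrac12)^2-2m/c^2}\Big]<\frac{2mbc}{c^2-1},\qquad (A)$$ and also $$\frac{bc}{c^2-1}<\frac{bc}{c^2-1}\Big[\tfrac32+m-\sqrt{(m+\tfrac12)^2-2m/c^2}\Big]<\mathbb{E}[X]-M<\frac{2bc}{c^2-1}.\qquad (B)$$ Moreover, for $m>0$, $$M>\frac{bc}{c^2-1}\Big[m-1+\sqrt{(m-1)^2+4(c^2-1)m/c^2}\Big].$$ The (outermost) lower and upper bounds in (A) are best possible amongst all bounds of the form $(2m-a)bc/(c^2-1)$, where $a\in\mathbb{R}$ does not involve the parameters: for no $a<1$ is this a lower bound for $M$ for all $m>0$, $b>0$, $c>1$, and for no $a>0$ is this an upper bound for $M$ for all $m>0$, $b>0$, $c>1$. Also, the (outermost) lower and upper bounds in (B) are best possible amongst all bounds of the form $\kappa bc/(c^2-1)$, where $\kappa\in\mathbb{R}$ does not involve the parameters: for no $\kappa>1$ is this a lower bound, and for no $\kappa<2$ is this an upper bound, for $\mathbb{E}[X]-M$ for all $m>0$, $b>0$, $c>1$.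
   Context: For $\nu>-1$ and $x>0$, $I_\nu(x)=\sum_{k=0}^\infty \frac{(x/2)^{\nu+2k}}{\Gamma(\nu+k+1)\,k!}$ is the modified Bessel function of the first kind. McKay Type I distribution: for $b>0$, $c>1$, $m>-1/2$, it is the distribution on $(0,\infty)$ with density $$p(x)=\frac{\sqrt{\pi}(c^2-1)^{m+1/2}}{2^mb^{m+1}\Gamma(m+\frac{1}{2})}\,x^m\mathrm{e}^{-cx/b}I_m\Big(\frac{x}{b}\Big),\qquad x>0.$$ A distribution is unimodal with mode $M$ if its density is non-decreasing to the left of $M$ and non-increasing to the right of $M$ (the density being $0$ on $(-\infty,0)$); in particular the mode is $0$ if the density is decreasing on $(0,\infty)$. *)

theory Defs
  imports "HOL-Probability.Probability"
begin

text \<open>Modified Bessel function of the first kind; only used for \<open>\<nu> > -1\<close> and \<open>x > 0\<close>.\<close>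

definition bessel_I :: "real \<Rightarrow> real \<Rightarrow> real" where
  "bessel_I \<nu> x = (\<Sum>k. (x / 2) powr (\<nu> + 2 * real k) / (Gamma (\<nu> + real k + 1) * fact k))"

definition mckay1_density :: "real \<Rightarrow> real \<Rightarrow> real \<Rightarrow> real \<Rightarrow> real" where
  "mckay1_density m b c x =
     (if x > 0
      then sqrt pi * (c\<^sup>2 - 1) powr (m + 1/2) / (2 powr m * b powr (m + 1) * Gamma (m + 1/2))
           * x powr m * exp (- c * x / b) * bessel_I m (x / b)
      else 0)"

definition mckay1 :: "real \<Rightarrow> real \<Rightarrow> real \<Rightarrow> real measure" where
  "mckay1 m b c = density lborel (\<lambda>x. ennreal (mckay1_density m b c x))"

text \<open>A density of a distribution is only determined up to null sets, so the monotonicity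
  conditions are imposed on some version of it. The two intervals are open: nothing is required of
  the value at the mode, where the density may have a jump or a pole.\<close>

definition unimodal_with_mode :: "real measure \<Rightarrow> real \<Rightarrow> bool" where
  "unimodal_with_mode D M \<longleftrightarrow>
     (\<exists>p :: real \<Rightarrow> real. p \<in> borel_measurable lborel \<and> (\<forall>x. 0 \<le> p x) \<and>
        D = density lborel (\<lambda>x. ennreal (p x)) \<and>
        mono_on {..<M} p \<and> antimono_on {M<..} p)"

end

theory Submission
  imports Defs
begin

text \<open>Up to scaling, the density is \<open>y\<^sup>m exp (-c y) I\<^sub>m(y)\<close>, and since
  \<open>(y\<^sup>m I\<^sub>m)' = y\<^sup>m I\<^sub>m\<^sub>-\<^sub>1\<close> its derivative has the sign of \<open>I\<^sub>m\<^sub>-\<^sub>1 / I\<^sub>m - c\<close>. The function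
  \<open>w(y) = y I\<^sub>m\<^sub>-\<^sub>1(y) / I\<^sub>m(y)\<close> solves the Riccati equation \<open>y w' = y\<^sup>2 + 2 m w - w\<^sup>2\<close> with
  \<open>w(0) = 2 m\<close>. Comparing \<open>w\<close> with the barriers \<open>m - \<alpha> + sqrt (\<beta>\<^sup>2 + y\<^sup>2)\<close> for
  \<open>(\<alpha>, \<beta>) = (1/2, m + 1/2), (1, m + 1), (1/2, m - 1/2)\<close> shows that \<open>w\<close> crosses the line \<open>c y\<close>
  exactly once if \<open>m > 0\<close> and locates the crossing; for \<open>m \<le> 0\<close> it stays below the line. The
  bounds for \<open>E X - M\<close> are then equivalent to those for \<open>M\<close> because \<open>E X = (2 m + 1) b c / (c\<^sup>2 - 1)\<close>.
  Sharpness is already visible at \<open>m = b = 1\<close>, letting \<open>c\<close> tend to \<open>1\<close> or to \<open>\<infinity>\<close>.\<close>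

subsection \<open>The ratio of modified Bessel functions\<close>

text \<open>The entire part of the Bessel function:
  \<open>I_nu(x) = (x/2)^nu * bessel_clifford nu (x^2/4)\<close> for \<open>x > 0\<close>. Writing
  the coefficients with \<open>rGamma\<close> instead of \<open>1 / Gamma\<close> makes them free of
  poles, so the identities below hold for every real index.\<close>

definition bessel_clifford :: "real \<Rightarrow> real \<Rightarrow> real" where
  "bessel_clifford \<nu> z = (\<Sum>k. rGamma (\<nu> + real k + 1) / fact k * z ^ k)"

text \<open>Consecutive terms have ratio \<open>z / ((k + 1) * (\<nu> + k + 1))\<close>, whose
  modulus is at most 1/2 once \<open>\<nu> + k + 1\<close> exceeds twice the modulus of
  \<open>z\<close>; \<open>N\<close> guarantees this.\<close>

lemma summable_bessel_clifford: "summable (\<lambda>k. rGamma (\<nu> + real k + 1) / fact k * z ^ k)"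
proof -
  obtain N :: nat where N: "2 * \<bar>z\<bar> + \<bar>\<nu>\<bar> + 1 \<le> real N"
    using real_arch_simple by blast
  show ?thesis
  proof (rule summable_ratio_test[of "1/2" N])
    fix k assume k: "N \<le> k"
    define g where "g = rGamma (\<nu> + real (Suc k) + 1)"
    have rec: "rGamma (\<nu> + real k + 1) = (\<nu> + real k + 1) * g"
      using rGamma_plus1[of "\<nu> + real k + 1"] by (simp add: g_def add_ac)
    have big: "2 * \<bar>z\<bar> \<le> \<nu> + real k + 1"
      using N k by linarith
    have "\<bar>z\<bar> / (real k + 1) \<le> \<bar>z\<bar>"
      by (simp add: divide_le_eq mult_le_cancel_left1)
    also have "\<dots> \<le> (\<nu> + real k + 1) / 2" using big by simp
    finally have "\<bar>g\<bar> * \<bar>z\<bar> ^ k / fact k * (\<bar>z\<bar> / (real k + 1))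
        \<le> \<bar>g\<bar> * \<bar>z\<bar> ^ k / fact k * ((\<nu> + real k + 1) / 2)"
      by (rule mult_left_mono) simp
    moreover have "norm (g / fact (Suc k) * z ^ Suc k)
        = \<bar>g\<bar> * \<bar>z\<bar> ^ k / fact k * (\<bar>z\<bar> / (real k + 1))"
      by (simp add: abs_mult power_abs add_ac mult_ac)
    moreover have "1/2 * norm ((\<nu> + real k + 1) * g / fact k * z ^ k)
        = \<bar>g\<bar> * \<bar>z\<bar> ^ k / fact k * ((\<nu> + real k + 1) / 2)"
      using big by (simp add: abs_mult power_abs mult_ac)
    ultimately show "norm (rGamma (\<nu> + real (Suc k) + 1) / fact (Suc k) * z ^ Suc k)
        \<le> 1/2 * norm (rGamma (\<nu> + real k + 1) / fact k * z ^ k)"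
      unfolding rec g_def[symmetric] by simp
  qed simp
qed

text \<open>Differentiating termwise, the factor \<open>k + 1\<close> cancels against the factorial,
  so that only the Gamma argument is shifted.\<close>

lemma DERIV_bessel_clifford:
  "(bessel_clifford \<nu> has_field_derivative bessel_clifford (\<nu> + 1) z) (at z)"
proof -
  let ?c = "\<lambda>k. rGamma (\<nu> + real k + 1) / fact k"
  have "((\<lambda>x. \<Sum>k. ?c k * x ^ k) has_field_derivative (\<Sum>k. diffs ?c k * z ^ k)) (at z)"
    by (rule termdiffs_strong_converges_everywhere) (rule summable_bessel_clifford)
  moreover have "diffs ?c k = rGamma (\<nu> + 1 + real k + 1) / fact k" for k
    by (simp add: diffs_def add_ac del: of_nat_Suc) (simp add: add_ac)
  ultimately show ?thesis
    by (simp add: bessel_clifford_def[abs_def])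
qed

lemmas DERIV_bessel_clifford_chain [derivative_intros] = DERIV_chain2[OF DERIV_bessel_clifford]

lemma continuous_on_bessel_clifford: "continuous_on A (bessel_clifford \<nu>)"
  by (meson DERIV_bessel_clifford DERIV_isCont continuous_at_imp_continuous_on)

lemma continuous_on_bessel_clifford_comp [continuous_intros]:
  "continuous_on A f \<Longrightarrow> continuous_on A (\<lambda>x. bessel_clifford \<nu> (f x))"
  using continuous_on_compose2[OF continuous_on_bessel_clifford[of UNIV]] by blast

text \<open>This is the three-term recurrence
  \<open>I_nu - I_(nu+2) = 2 (nu+1) / x * I_(nu+1)\<close>. On coefficients it is
  \<open>1 / Gamma(a) = a / Gamma(a + 1)\<close> with \<open>a = \<nu> + 1 + k\<close> split into
  \<open>\<nu> + 1\<close> and \<open>k\<close>.\<close>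

lemma bessel_clifford_rec:
  "bessel_clifford \<nu> z = (\<nu> + 1) * bessel_clifford (\<nu> + 1) z + z * bessel_clifford (\<nu> + 2) z"
proof -
  let ?t = "\<lambda>\<nu> k. rGamma (\<nu> + real k + 1) / fact k * z ^ k"
  have s: "?t \<nu> sums bessel_clifford \<nu> z" for \<nu>
    unfolding bessel_clifford_def by (rule summable_sums) (rule summable_bessel_clifford)
  have eq: "rGamma (\<nu> + 2 + real k + 1) / fact k * z ^ k * z
      = real (Suc k) * ?t (\<nu> + 1) (Suc k)" for k
    by (simp add: add_ac del: of_nat_Suc) (simp add: add_ac)
  have "(\<lambda>k. real (Suc k) * ?t (\<nu> + 1) (Suc k)) sums (z * bessel_clifford (\<nu> + 2) z)"
    using sums_mult2[OF s[of "\<nu> + 2"], of z] unfolding eq by (simp add: mult.commute)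
  \<comment> \<open>The term for \<open>k = 0\<close> carries the factor 0, so undoing the index
    shift adds nothing.\<close>
  then have "(\<lambda>k. real k * ?t (\<nu> + 1) k) sums (z * bessel_clifford (\<nu> + 2) z)"
    by (subst (asm) sums_Suc_iff) simp
  then have "(\<lambda>k. (\<nu> + 1) * ?t (\<nu> + 1) k + real k * ?t (\<nu> + 1) k) sums
      ((\<nu> + 1) * bessel_clifford (\<nu> + 1) z + z * bessel_clifford (\<nu> + 2) z)"
    by (intro sums_add sums_mult s)
  moreover have "(\<nu> + 1) * ?t (\<nu> + 1) k + real k * ?t (\<nu> + 1) k = ?t \<nu> k" for k
  proof -
    have "rGamma (\<nu> + real k + 1) = (\<nu> + 1 + real k) * rGamma (\<nu> + 1 + real k + 1)"
      using rGamma_plus1[of "\<nu> + real k + 1"] by (simp add: add_ac)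
    then show ?thesis by (simp add: algebra_simps add_divide_distrib)
  qed
  ultimately show ?thesis
    using s[of \<nu>] sums_unique2 by simp
qed

lemma bessel_clifford_pos:
  assumes "\<nu> > -1" "z \<ge> 0"
  shows "bessel_clifford \<nu> z > 0"
proof -
  have pos: "rGamma (\<nu> + real k + 1) > 0" for k
    using assms by (simp add: rGamma_inverse_Gamma Gamma_real_pos)
  show ?thesis
    unfolding bessel_clifford_def
    by (rule suminf_pos2[of _ 0, OF summable_bessel_clifford])
      (use pos pos[of 0] assms in \<open>auto intro!: mult_nonneg_nonneg divide_nonneg_nonneg less_imp_le[OF pos]\<close>)
qed

lemma bessel_I_eq_bessel_clifford:
  assumes "x > 0"
  shows "bessel_I \<nu> x = (x / 2) powr \<nu> * bessel_clifford \<nu> (x\<^sup>2 / 4)"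
proof -
  have "(x / 2) powr (\<nu> + 2 * real k) / (Gamma (\<nu> + real k + 1) * fact k)
      = (x / 2) powr \<nu> * (rGamma (\<nu> + real k + 1) / fact k * (x\<^sup>2 / 4) ^ k)" for k
  proof -
    have "(x / 2) powr (2 * real k) = ((x / 2)\<^sup>2) ^ k"
      using assms powr_realpow[of "x/2" "2*k"] by (simp add: power_mult)
    also have "(x / 2)\<^sup>2 = x\<^sup>2 / 4" by (simp add: power2_eq_square)
    finally show ?thesis
      by (simp add: powr_add rGamma_inverse_Gamma divide_simps)
  qed
  then show ?thesis
    unfolding bessel_I_def bessel_clifford_def
    by (simp only: suminf_mult[OF summable_bessel_clifford])
qed

section \<open>The ratio and its Riccati equation\<close>

text \<open>\<open>bessel_ratio \<nu> y = y I\<^sub>\<nu>\<^sub>-\<^sub>1(y) / I\<^sub>\<nu>(y)\<close>, extended continuously to \<open>y = 0\<close>.\<close>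

definition bessel_ratio :: "real \<Rightarrow> real \<Rightarrow> real" where
  "bessel_ratio \<nu> y =
     2 * \<nu> + y\<^sup>2 / 2 * bessel_clifford (\<nu> + 1) (y\<^sup>2 / 4) / bessel_clifford \<nu> (y\<^sup>2 / 4)"

lemma bessel_ratio_0 [simp]: "bessel_ratio \<nu> 0 = 2 * \<nu>"
  by (simp add: bessel_ratio_def)

lemma bessel_ratio_gt: "\<nu> > -1 \<Longrightarrow> y > 0 \<Longrightarrow> bessel_ratio \<nu> y > 2 * \<nu>"
  using bessel_clifford_pos[of \<nu> "y\<^sup>2 / 4"] bessel_clifford_pos[of "\<nu> + 1" "y\<^sup>2 / 4"]
  by (simp add: bessel_ratio_def)

lemma continuous_on_bessel_ratio:
  "\<nu> > -1 \<Longrightarrow> continuous_on A (bessel_ratio \<nu>)"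
  unfolding bessel_ratio_def
  by (intro continuous_intros) (use bessel_clifford_pos[of \<nu>] in \<open>auto simp: less_imp_neq[symmetric]\<close>)

text \<open>The quotient rule produces functions of index \<open>\<nu>\<close>,
  \<open>\<nu> + 1\<close> and \<open>\<nu> + 2\<close>; the recurrence eliminates the last one, and
  what remains is a quadratic polynomial in the ratio.\<close>

lemma DERIV_bessel_ratio:
  assumes "\<nu> > -1" "y > 0"
  shows "(bessel_ratio \<nu> has_field_derivative
    (y\<^sup>2 + 2 * \<nu> * bessel_ratio \<nu> y - (bessel_ratio \<nu> y)\<^sup>2) / y) (at y)"
proof -
  define A B D where "A = bessel_clifford \<nu> (y\<^sup>2 / 4)" and "B = bessel_clifford (\<nu> + 1) (y\<^sup>2 / 4)"
    and "D = bessel_clifford (\<nu> + 2) (y\<^sup>2 / 4)"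
  have A: "A > 0" using assms unfolding A_def by (intro bessel_clifford_pos) auto
  have rec: "A = (\<nu> + 1) * B + y\<^sup>2 / 4 * D"
    unfolding A_def B_def D_def by (rule bessel_clifford_rec)
  have dA: "((\<lambda>y. bessel_clifford \<nu> (y\<^sup>2 / 4)) has_field_derivative B * (y / 2)) (at y)"
    unfolding B_def by (auto intro!: derivative_eq_intros)
  have dB: "((\<lambda>y. bessel_clifford (\<nu> + 1) (y\<^sup>2 / 4)) has_field_derivative D * (y / 2)) (at y)"
    unfolding D_def by (auto intro!: derivative_eq_intros simp: add.assoc)
  have d2: "((\<lambda>y. y\<^sup>2 / 2) has_field_derivative y) (at y)"
    by (auto intro!: derivative_eq_intros)
  have "(bessel_ratio \<nu> has_field_derivative
      0 + ((y * B + D * (y / 2) * (y\<^sup>2 / 2)) * A - y\<^sup>2 / 2 * B * (B * (y / 2))) / (A * A)) (at y)"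
    unfolding bessel_ratio_def
    using DERIV_add[OF DERIV_const DERIV_divide[OF DERIV_mult[OF d2 dB] dA]] A
    by (simp only: A_def[symmetric] B_def[symmetric])
  also have "0 + ((y * B + D * (y / 2) * (y\<^sup>2 / 2)) * A - y\<^sup>2 / 2 * B * (B * (y / 2))) / (A * A)
     = (y\<^sup>2 + 2 * \<nu> * bessel_ratio \<nu> y - (bessel_ratio \<nu> y)\<^sup>2) / y"
  proof -
    have D: "y\<^sup>2 * D = 4 * (A - (\<nu> + 1) * B)" using rec by simp
    have "(y * B + D * (y / 2) * (y\<^sup>2 / 2)) = y * B + y / 4 * (y\<^sup>2 * D)"
      by (simp add: power2_eq_square)
    also have "\<dots> = y * A - \<nu> * y * B" unfolding D by (simp add: algebra_simps)
    finally have *: "(y * B + D * (y / 2) * (y\<^sup>2 / 2)) = y * A - \<nu> * y * B" .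
    have r: "bessel_ratio \<nu> y = 2 * \<nu> + y\<^sup>2 / 2 * B / A"
      by (simp add: bessel_ratio_def A_def B_def)
    show ?thesis unfolding * r using A assms
      by (simp add: field_simps power2_eq_square)
  qed
  finally show ?thesis .
qed

section \<open>Comparison of the ratio with barriers\<close>

text \<open>At a minimum of \<open>d\<close> over \<open>{a..y}\<close> the derivative cannot be positive.\<close>

lemma barrier_pos:
  fixes d d' :: "real \<Rightarrow> real"
  assumes cont: "continuous_on {a..} d" and start: "d a \<ge> 0"
    and der: "\<And>y. y > a \<Longrightarrow> (d has_field_derivative d' y) (at y)"
    and up: "\<And>y. y > a \<Longrightarrow> d y \<le> 0 \<Longrightarrow> d' y > 0"
    and "y > a"
  shows "d y > 0"
proof (rule ccontr)
  assume "\<not> d y > 0"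
  have "\<exists>t\<in>{a..y}. \<forall>s\<in>{a..y}. d t \<le> d s"
    using \<open>y > a\<close> by (intro continuous_attains_inf continuous_on_subset[OF cont]) auto
  then obtain t0 where t0: "t0 \<in> {a..y}" "\<And>s. s \<in> {a..y} \<Longrightarrow> d t0 \<le> d s" by blast
  \<comment> \<open>A minimum point different from \<open>a\<close> is needed, since the derivative
    is only controlled to the right of \<open>a\<close>. If the minimum sits at \<open>a\<close>,
    then \<open>d a \<ge> 0\<close> and \<open>d y \<le> 0\<close> force equality, and
    \<open>y\<close> itself is a minimum point.\<close>
  obtain t where t: "a < t" "t \<le> y" "d t \<le> 0" "\<And>s. s \<in> {a..y} \<Longrightarrow> d t \<le> d s"
  proof (cases "t0 = a")
    case True
    with t0(2)[of y] start \<open>\<not> d y > 0\<close> \<open>y > a\<close> have "d y = d t0" by auto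
    with that[of y] t0 \<open>\<not> d y > 0\<close> \<open>y > a\<close> show ?thesis by auto
  next
    case False
    have "d t0 \<le> d y" using t0(2)[of y] \<open>y > a\<close> by simp
    with \<open>\<not> d y > 0\<close> have "d t0 \<le> 0" by linarith
    with False t0 show ?thesis by (intro that[of t0]) auto
  qed
  obtain e where e: "e > 0" "\<And>h. 0 < h \<Longrightarrow> h < e \<Longrightarrow> d (t - h) < d t"
    using DERIV_pos_inc_left[OF der[OF t(1)] up[OF t(1,3)]] by blast
  \<comment> \<open>Capping by \<open>t - a\<close> keeps \<open>t - h\<close> inside the interval
    on which \<open>d t\<close> is minimal.\<close>
  define h where "h = min (e / 2) (t - a)"
  have "0 < h" "h < e" "h \<le> t - a" using e(1) t(1) by (auto simp: h_def)
  with e(2)[of h] t(4)[of "t - h"] t(2) show False by auto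
qed

lemma DERIV_sqrt_add_square:
  fixes y :: real
  assumes "y \<noteq> 0"
  shows "((\<lambda>y. sqrt (a\<^sup>2 + y\<^sup>2)) has_field_derivative y / sqrt (a\<^sup>2 + y\<^sup>2)) (at y)"
proof -
  have "0 < a\<^sup>2 + y\<^sup>2" using assms by (simp add: add_nonneg_pos)
  then show ?thesis
    by (auto intro!: derivative_eq_intros simp: field_simps)
qed

text \<open>The difference of the two sides factors as \<open>(b - a) * (a + b - 2 * m)\<close>.
  This lets the unknown ratio be replaced by the barrier in the Riccati right-hand side at a point
  where the barrier would be violated.\<close>

lemma riccati_rhs_antimono:
  fixes a b :: real
  assumes "a \<le> b" "2 * m \<le> a + b"
  shows "y\<^sup>2 + 2 * m * b - b\<^sup>2 \<le> y\<^sup>2 + 2 * m * a - a\<^sup>2"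
proof -
  have "0 \<le> (b - a) * (a + b - 2 * m)"
    using assms by (intro mult_nonneg_nonneg) auto
  then show ?thesis by (simp add: algebra_simps power2_eq_square)
qed

text \<open>Ratio and barrier both start at \<open>2 * m\<close>. With \<open>s\<close> the square
  root, the Riccati right-hand side at the barrier is \<open>s - m - 1/2\<close>, which is smaller
  than \<open>y\<close> times the slope of the barrier, namely \<open>y^2 / s\<close>. So the
  barrier rises faster wherever the ratio would reach it.\<close>

lemma bessel_ratio_less:
  assumes m: "m > 0" and "y > 0"
  shows "bessel_ratio m y < m - 1/2 + sqrt ((m + 1/2)\<^sup>2 + y\<^sup>2)"
proof -
  define s where "s = (\<lambda>y. sqrt ((m + 1/2)\<^sup>2 + y\<^sup>2))"
  have s2: "(s y)\<^sup>2 = (m + 1/2)\<^sup>2 + y\<^sup>2" for y by (simp add: s_def)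
  have s_gt: "s y > m + 1/2" if "y > 0" for y
    using m that unfolding s_def by (intro real_less_rsqrt) auto
  have "0 < m - 1/2 + s y - bessel_ratio m y"
  proof (rule barrier_pos[where a = 0 and d = "\<lambda>y. m - 1/2 + s y - bessel_ratio m y"
      and d' = "\<lambda>y. y / s y - (y\<^sup>2 + 2 * m * bessel_ratio m y - (bessel_ratio m y)\<^sup>2) / y"])
    show "continuous_on {0..} (\<lambda>y. m - 1/2 + s y - bessel_ratio m y)"
      unfolding s_def using m by (intro continuous_intros continuous_on_bessel_ratio) auto
    show "0 \<le> m - 1/2 + s 0 - bessel_ratio m 0" using m by (simp add: s_def)
  next
    fix y :: real assume y: "y > 0"
    have "(s has_field_derivative y / s y) (at y)"
      unfolding s_def using y by (intro DERIV_sqrt_add_square) auto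
    then show "((\<lambda>y. m - 1/2 + s y - bessel_ratio m y) has_field_derivative
        y / s y - (y\<^sup>2 + 2 * m * bessel_ratio m y - (bessel_ratio m y)\<^sup>2) / y) (at y)"
      using m y by (auto intro!: derivative_eq_intros DERIV_bessel_ratio)
    let ?w = "bessel_ratio m y" and ?B = "m - 1/2 + s y"
    assume le: "m - 1/2 + s y - ?w \<le> 0"
    have sy: "s y > m + 1/2" using s_gt y .
    have y2: "y\<^sup>2 = (s y)\<^sup>2 - (m + 1/2)\<^sup>2" using s2[of y] by simp
    have "y\<^sup>2 + 2 * m * ?w - ?w\<^sup>2 \<le> y\<^sup>2 + 2 * m * ?B - ?B\<^sup>2"
      using le sy m by (intro riccati_rhs_antimono) auto
    also have "\<dots> = s y - m - 1/2" unfolding y2 by (simp add: field_simps power2_eq_square)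
    also have "\<dots> < y\<^sup>2 / s y"
    proof -
      have "(s y - m - 1/2) * s y < (s y - m - 1/2) * (s y + m + 1/2)"
        using sy m by (intro mult_strict_left_mono) auto
      also have "\<dots> = y\<^sup>2" unfolding y2 by (simp add: field_simps power2_eq_square)
      finally show ?thesis using sy m by (simp add: field_simps)
    qed
    finally show "0 < y / s y - (y\<^sup>2 + 2 * m * ?w - ?w\<^sup>2) / y"
      using y sy m by (simp add: field_simps power2_eq_square)
  qed (use assms in auto)
  then show ?thesis by (simp add: s_def)
qed

text \<open>The mirrored comparison, again starting at \<open>2 * m\<close>: at this barrier the
  Riccati right-hand side is \<open>2 * (s - m - 1)\<close>, and it exceeds \<open>y^2 / s\<close>
  because \<open>s + m + 1 < 2 * s\<close>. The barrier agrees with the ratio up to second order at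
  0.\<close>

lemma bessel_ratio_greater:
  assumes m: "m > 0" and "y > 0"
  shows "bessel_ratio m y > m - 1 + sqrt ((m + 1)\<^sup>2 + y\<^sup>2)"
proof -
  define s where "s = (\<lambda>y. sqrt ((m + 1)\<^sup>2 + y\<^sup>2))"
  have s2: "(s y)\<^sup>2 = (m + 1)\<^sup>2 + y\<^sup>2" for y by (simp add: s_def)
  have s_gt: "s y > m + 1" if "y > 0" for y
    using m that unfolding s_def by (intro real_less_rsqrt) auto
  have "0 < bessel_ratio m y - (m - 1 + s y)"
  proof (rule barrier_pos[where a = 0 and d = "\<lambda>y. bessel_ratio m y - (m - 1 + s y)"
      and d' = "\<lambda>y. (y\<^sup>2 + 2 * m * bessel_ratio m y - (bessel_ratio m y)\<^sup>2) / y - y / s y"])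
    show "continuous_on {0..} (\<lambda>y. bessel_ratio m y - (m - 1 + s y))"
      unfolding s_def using m by (intro continuous_intros continuous_on_bessel_ratio) auto
    show "0 \<le> bessel_ratio m 0 - (m - 1 + s 0)" using m by (simp add: s_def)
  next
    fix y :: real assume y: "y > 0"
    have "(s has_field_derivative y / s y) (at y)"
      unfolding s_def using y by (intro DERIV_sqrt_add_square) auto
    then show "((\<lambda>y. bessel_ratio m y - (m - 1 + s y)) has_field_derivative
        (y\<^sup>2 + 2 * m * bessel_ratio m y - (bessel_ratio m y)\<^sup>2) / y - y / s y) (at y)"
      using m y by (auto intro!: derivative_eq_intros DERIV_bessel_ratio)
    let ?w = "bessel_ratio m y" and ?A = "m - 1 + s y"
    assume le: "?w - (m - 1 + s y) \<le> 0"
    have sy: "s y > m + 1" using s_gt y .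
    have y2: "y\<^sup>2 = (s y)\<^sup>2 - (m + 1)\<^sup>2" using s2[of y] by simp
    have w: "?w > 2 * m" using m y by (intro bessel_ratio_gt) auto
    have "y\<^sup>2 / s y < 2 * (s y - m - 1)"
    proof -
      have "y\<^sup>2 = (s y - m - 1) * (s y + m + 1)"
        unfolding y2 by (simp add: field_simps power2_eq_square)
      also have "\<dots> < (s y - m - 1) * (2 * s y)"
        using sy m by (intro mult_strict_left_mono) auto
      finally show ?thesis using sy m by (simp add: field_simps)
    qed
    also have "\<dots> = y\<^sup>2 + 2 * m * ?A - ?A\<^sup>2" unfolding y2 by (simp add: field_simps power2_eq_square)
    also have "\<dots> \<le> y\<^sup>2 + 2 * m * ?w - ?w\<^sup>2"
      using le sy m w by (intro riccati_rhs_antimono) auto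
    finally show "0 < (y\<^sup>2 + 2 * m * ?w - ?w\<^sup>2) / y - y / s y"
      using y sy m by (simp add: field_simps power2_eq_square)
  qed (use assms in auto)
  then show ?thesis by (simp add: s_def)
qed

text \<open>The right-hand side is the null isocline of the Riccati equation satisfied by
  \<open>bessel_ratio m y / y\<close>, so this bound says that \<open>I\<^sub>m\<^sub>-\<^sub>1 / I\<^sub>m\<close> is decreasing.\<close>

lemma bessel_ratio_greater_isocline:
  assumes m: "m > 1/2" and "y > 0"
  shows "bessel_ratio m y > m - 1/2 + sqrt ((m - 1/2)\<^sup>2 + y\<^sup>2)"
proof -
  define s where "s = (\<lambda>y. sqrt ((m - 1/2)\<^sup>2 + y\<^sup>2))"
  have s2: "(s y)\<^sup>2 = (m - 1/2)\<^sup>2 + y\<^sup>2" for y by (simp add: s_def)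
  have s_gt: "s y > m - 1/2" if "y > 0" for y
    using m that unfolding s_def by (intro real_less_rsqrt) auto
  have "0 < bessel_ratio m y - (m - 1/2 + s y)"
  proof (rule barrier_pos[where a = 0 and d = "\<lambda>y. bessel_ratio m y - (m - 1/2 + s y)"
      and d' = "\<lambda>y. (y\<^sup>2 + 2 * m * bessel_ratio m y - (bessel_ratio m y)\<^sup>2) / y - y / s y"])
    show "continuous_on {0..} (\<lambda>y. bessel_ratio m y - (m - 1/2 + s y))"
      unfolding s_def using m by (intro continuous_intros continuous_on_bessel_ratio) auto
    show "0 \<le> bessel_ratio m 0 - (m - 1/2 + s 0)" using m by (simp add: s_def)
  next
    fix y :: real assume y: "y > 0"
    have "(s has_field_derivative y / s y) (at y)"
      unfolding s_def using y by (intro DERIV_sqrt_add_square) auto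
    then show "((\<lambda>y. bessel_ratio m y - (m - 1/2 + s y)) has_field_derivative
        (y\<^sup>2 + 2 * m * bessel_ratio m y - (bessel_ratio m y)\<^sup>2) / y - y / s y) (at y)"
      using m y by (auto intro!: derivative_eq_intros DERIV_bessel_ratio)
    let ?w = "bessel_ratio m y" and ?A = "m - 1/2 + s y"
    assume le: "?w - (m - 1/2 + s y) \<le> 0"
    have sy: "s y > m - 1/2" using s_gt y .
    have y2: "y\<^sup>2 = (s y)\<^sup>2 - (m - 1/2)\<^sup>2" using s2[of y] by simp
    have w: "?w > 2 * m" using m y by (intro bessel_ratio_gt) auto
    have "y\<^sup>2 \<le> (s y)\<^sup>2" unfolding s2 by simp
    then have "y\<^sup>2 / s y \<le> s y"
      using sy m by (simp add: field_simps power2_eq_square)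
    also have "s y < ?A" using m by simp
    \<comment> \<open>On the isocline the Riccati right-hand side equals the barrier itself, which
      exceeds \<open>s y\<close> because \<open>m > 1/2\<close>.\<close>
    also have "\<dots> = y\<^sup>2 + 2 * m * ?A - ?A\<^sup>2" unfolding y2 by (simp add: field_simps power2_eq_square)
    also have "\<dots> \<le> y\<^sup>2 + 2 * m * ?w - ?w\<^sup>2"
      using le sy m w by (intro riccati_rhs_antimono) auto
    finally show "0 < (y\<^sup>2 + 2 * m * ?w - ?w\<^sup>2) / y - y / s y"
      using y sy m by (simp add: field_simps power2_eq_square)
  qed (use assms in auto)
  then show ?thesis by (simp add: s_def)
qed

text \<open>Where the ratio \<open>w\<close> is at least \<open>c * y\<close>, it exceeds
  \<open>y\<close>; together with \<open>m \<le> 0\<close> this makes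
  \<open>y^2 + 2 * m * w - w^2\<close> negative. The ratio would then be falling while the line
  rises.\<close>

lemma bessel_ratio_below_line:
  assumes m: "m > -1/2" "m \<le> 0" and c: "c > 1" and "y > 0"
  shows "bessel_ratio m y < c * y"
proof -
  have "0 < c * y - bessel_ratio m y"
  proof (rule barrier_pos[where a = 0 and d = "\<lambda>y. c * y - bessel_ratio m y"
      and d' = "\<lambda>y. c - (y\<^sup>2 + 2 * m * bessel_ratio m y - (bessel_ratio m y)\<^sup>2) / y"])
    show "continuous_on {0..} (\<lambda>y. c * y - bessel_ratio m y)"
      using m by (intro continuous_intros continuous_on_bessel_ratio) auto
  next
    fix y :: real assume y: "y > 0"
    then show "((\<lambda>y. c * y - bessel_ratio m y) has_field_derivative
        c - (y\<^sup>2 + 2 * m * bessel_ratio m y - (bessel_ratio m y)\<^sup>2) / y) (at y)"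
      using m by (auto intro!: derivative_eq_intros DERIV_bessel_ratio)
    let ?w = "bessel_ratio m y"
    assume "c * y - ?w \<le> 0"
    moreover have "y < c * y" using c y by simp
    ultimately have "y < ?w" by simp
    then have "y\<^sup>2 < ?w\<^sup>2" using y by (intro power_strict_mono) auto
    moreover have "2 * m * ?w \<le> 0"
      using m y \<open>y < ?w\<close> by (intro mult_nonpos_nonneg[of "2 * m"]) auto
    ultimately have "(y\<^sup>2 + 2 * m * ?w - ?w\<^sup>2) / y < 0"
      using y by (intro divide_neg_pos) auto
    then show "0 < c - (y\<^sup>2 + 2 * m * ?w - ?w\<^sup>2) / y" using c by linarith
  qed (use assms in auto)
  then show ?thesis by simp
qed

text \<open>Dividing by \<open>y\<close> turns the line into the constant \<open>c\<close>. As long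
  as the quotient is at least \<open>c > 1\<close> it is strictly decreasing: for
  \<open>m > 1/2\<close> by the isocline bound, otherwise because \<open>2 * m - 1 \<le> 0\<close>
  and the ratio exceeds \<open>y\<close>. Hence it cannot return to \<open>c\<close>.\<close>

lemma bessel_ratio_crossing_persists:
  assumes m: "m > 0" and c: "c > 1" and "a > 0" "bessel_ratio m a \<le> c * a" "y > a"
  shows "bessel_ratio m y < c * y"
proof -
  have "0 < c - bessel_ratio m y / y"
  proof (rule barrier_pos[where a = a and d = "\<lambda>y. c - bessel_ratio m y / y"
      and d' = "\<lambda>y. ((bessel_ratio m y)\<^sup>2 - (2 * m - 1) * bessel_ratio m y - y\<^sup>2) / y\<^sup>2"])
    show "continuous_on {a..} (\<lambda>y. c - bessel_ratio m y / y)"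
      using m \<open>a > 0\<close> by (intro continuous_intros continuous_on_bessel_ratio) auto
    show "0 \<le> c - bessel_ratio m a / a" using assms by (simp add: field_simps)
  next
    fix y :: real assume "y > a"
    with \<open>a > 0\<close> have y: "y > 0" by simp
    let ?w = "bessel_ratio m y"
    show "((\<lambda>y. c - bessel_ratio m y / y) has_field_derivative
        (?w\<^sup>2 - (2 * m - 1) * ?w - y\<^sup>2) / y\<^sup>2) (at y)"
      using m y
      by (auto intro!: derivative_eq_intros DERIV_bessel_ratio simp: field_simps power2_eq_square)
    assume "c - ?w / y \<le> 0"
    then have "c * y \<le> ?w" using y by (simp add: field_simps)
    moreover have "y < c * y" using c y by simp
    ultimately have "y < ?w" by simp
    have "0 < ?w\<^sup>2 - (2 * m - 1) * ?w - y\<^sup>2"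
    proof (cases "m > 1/2")
      case True
      have "(sqrt ((m - 1/2)\<^sup>2 + y\<^sup>2))\<^sup>2 < (?w - (m - 1/2))\<^sup>2"
        using bessel_ratio_greater_isocline[OF True y] by (intro power_strict_mono) auto
      then show ?thesis by (simp add: power2_eq_square algebra_simps)
    next
      case False
      have "y\<^sup>2 < ?w\<^sup>2" using \<open>y < ?w\<close> y by (intro power_strict_mono) auto
      moreover have "(2 * m - 1) * ?w \<le> 0"
        using False y \<open>y < ?w\<close> by (intro mult_nonpos_nonneg) auto
      ultimately show ?thesis by simp
    qed
    then show "0 < (?w\<^sup>2 - (2 * m - 1) * ?w - y\<^sup>2) / y\<^sup>2" using y by simp
  qed (use assms in auto)
  then show ?thesis using assms by (simp add: field_simps)
qed

section \<open>Existence, uniqueness and location of the crossing\<close>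

lemma bessel_ratio_crossing:
  assumes m: "m > 0" and c: "c > 1"
  obtains M where "M > 0" "bessel_ratio m M = c * M"
    "\<And>y. 0 < y \<Longrightarrow> y < M \<Longrightarrow> bessel_ratio m y > c * y"
    "\<And>y. y > M \<Longrightarrow> bessel_ratio m y < c * y"
proof -
  \<comment> \<open>\<open>Y\<close> solves \<open>c * Y = 2 * m + Y\<close>, and
    \<open>2 * m + Y\<close> is the upper barrier at \<open>Y\<close> with its square root estimated
    by \<open>(m + 1/2) + Y\<close>. So the ratio is below the line at \<open>Y\<close>, and above
    it at 0.\<close>
  define Y where "Y = 2 * m / (c - 1)"
  have Y: "Y > 0" "c * Y = 2 * m + Y" using m c by (auto simp: Y_def field_simps)
  have "sqrt ((m + 1/2)\<^sup>2 + Y\<^sup>2) \<le> (m + 1/2) + Y"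
    using m Y by (intro real_le_lsqrt) (auto simp: power2_eq_square algebra_simps)
  with bessel_ratio_less[OF m Y(1)] have "bessel_ratio m Y < c * Y" using Y(2) by simp
  have "\<exists>M\<ge>0. M \<le> Y \<and> bessel_ratio m M - c * M = 0"
    using m Y(1) \<open>bessel_ratio m Y < c * Y\<close>
    by (intro IVT2' continuous_intros continuous_on_bessel_ratio) auto
  then obtain M where M: "M \<ge> 0" "bessel_ratio m M = c * M" by auto
  have "M \<noteq> 0" using M m by (intro notI) auto
  with M have "M > 0" by simp
  show ?thesis
  proof (rule that[OF \<open>M > 0\<close> M(2)])
    \<comment> \<open>Were the ratio on or below the line at \<open>y\<close>, it would be strictly
      below the line at \<open>M\<close>.\<close>
    fix y assume "0 < y" "y < M"
    with bessel_ratio_crossing_persists[OF m c, of y M] M show "bessel_ratio m y > c * y"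
      by force
  qed (use bessel_ratio_crossing_persists[OF m c \<open>M > 0\<close>] M in auto)
qed

text \<open>Solving for \<open>M\<close> in the bounds on \<open>bessel_ratio m M = c M\<close>: each of them is equivalent to a
  quadratic inequality for \<open>t\<close>.\<close>

lemma crossing_bounds:
  assumes m: "m > 0" and c: "c > 1" and M: "M > 0" "bessel_ratio m M = c * M"
  defines "t \<equiv> (c\<^sup>2 - 1) * M / c"
  shows "2 * m - 1 < t" "t < m - 1/2 + sqrt ((m + 1/2)\<^sup>2 - 2 * m / c\<^sup>2)"
    "m - 1 + sqrt ((m - 1)\<^sup>2 + 4 * (c\<^sup>2 - 1) * m / c\<^sup>2) < t"
proof -
  have c2: "c\<^sup>2 > 1" using c by simp
  have t: "t > 0" using c2 M c by (simp add: t_def)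
  \<comment> \<open>Multiplication by \<open>(c^2 - 1) / c^2\<close> turns a quadratic inequality in
    \<open>(c^2 - 1) * M^2\<close> and \<open>c * M\<close> into one in \<open>t^2\<close> and
    \<open>t\<close>.\<close>
  have tt: "t\<^sup>2 = (c\<^sup>2 - 1) / c\<^sup>2 * ((c\<^sup>2 - 1) * M\<^sup>2)"
    and tcM: "t = (c\<^sup>2 - 1) / c\<^sup>2 * (c * M)"
    using c by (auto simp: t_def power2_eq_square)
  have r: "(c\<^sup>2 - 1) / c\<^sup>2 > 0" using c2 by (intro divide_pos_pos) auto
  show 1: "2 * m - 1 < t"
  proof (cases "m > 1/2")
    case True
    have "(sqrt ((m - 1/2)\<^sup>2 + M\<^sup>2))\<^sup>2 < (c * M - (m - 1/2))\<^sup>2"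
      using bessel_ratio_greater_isocline[OF True M(1)] M by (intro power_strict_mono) auto
    then have "0 < (c\<^sup>2 - 1) * M\<^sup>2 - (2 * m - 1) * (c * M)"
      by (simp add: power2_eq_square algebra_simps)
    also have "(c\<^sup>2 - 1) * M\<^sup>2 - (2 * m - 1) * (c * M) = (t - (2 * m - 1)) * (c * M)"
      using c by (simp add: t_def field_simps power2_eq_square)
    finally have "0 < (t - (2 * m - 1)) * (c * M)" .
    moreover have "c * M > 0" using c M by simp
    ultimately show ?thesis by (simp add: zero_less_mult_iff)
  qed (use t in auto)
  have "2 * m < c * M" using bessel_ratio_gt[of m M] m M by auto
  have "(c * M - (m - 1/2))\<^sup>2 < (sqrt ((m + 1/2)\<^sup>2 + M\<^sup>2))\<^sup>2"
    using bessel_ratio_less[OF m M(1)] M m \<open>2 * m < c * M\<close> by (intro power_strict_mono) auto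
  also have "(sqrt ((m + 1/2)\<^sup>2 + M\<^sup>2))\<^sup>2 = (m + 1/2)\<^sup>2 + M\<^sup>2" by simp
  finally have "(c\<^sup>2 - 1) * M\<^sup>2 - (2 * m - 1) * (c * M) - 2 * m < 0"
    by (simp add: power2_eq_square algebra_simps)
  then have "(c\<^sup>2 - 1) / c\<^sup>2 * ((c\<^sup>2 - 1) * M\<^sup>2 - (2 * m - 1) * (c * M) - 2 * m) < 0"
    using r by (intro mult_pos_neg)
  also have "(c\<^sup>2 - 1) / c\<^sup>2 * ((c\<^sup>2 - 1) * M\<^sup>2 - (2 * m - 1) * (c * M) - 2 * m)
      = t\<^sup>2 - (2 * m - 1) * t - 2 * m * ((c\<^sup>2 - 1) / c\<^sup>2)"
    unfolding tt by (subst tcM) (simp only: algebra_simps)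
  also have "(c\<^sup>2 - 1) / c\<^sup>2 = 1 - 1 / c\<^sup>2" using c by (simp add: diff_divide_distrib)
  finally have "(t - (m - 1/2))\<^sup>2 < (m + 1/2)\<^sup>2 - 2 * m / c\<^sup>2"
    by (simp add: power2_eq_square algebra_simps)
  from real_less_rsqrt[OF this]
  show "t < m - 1/2 + sqrt ((m + 1/2)\<^sup>2 - 2 * m / c\<^sup>2)" by simp
  have "(sqrt ((m + 1)\<^sup>2 + M\<^sup>2))\<^sup>2 < (c * M - (m - 1))\<^sup>2"
    using bessel_ratio_greater[OF m M(1)] M by (intro power_strict_mono) auto
  then have "0 < (c\<^sup>2 - 1) * M\<^sup>2 - 2 * (m - 1) * (c * M) - 4 * m"
    by (simp add: power2_eq_square algebra_simps)
  then have "0 < (c\<^sup>2 - 1) / c\<^sup>2 * ((c\<^sup>2 - 1) * M\<^sup>2 - 2 * (m - 1) * (c * M) - 4 * m)"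
    using r by (intro mult_pos_pos)
  also have "\<dots> = t\<^sup>2 - 2 * (m - 1) * t - 4 * m * ((c\<^sup>2 - 1) / c\<^sup>2)"
    unfolding tt by (subst tcM) (simp only: algebra_simps)
  finally have "(m - 1)\<^sup>2 + 4 * (c\<^sup>2 - 1) * m / c\<^sup>2 < (t - (m - 1))\<^sup>2"
    by (simp add: power2_eq_square algebra_simps)
  \<comment> \<open>The first bound settles the sign that is needed for taking roots.\<close>
  moreover have "t - (m - 1) > 0" using 1 t m by linarith
  ultimately have "sqrt ((m - 1)\<^sup>2 + 4 * (c\<^sup>2 - 1) * m / c\<^sup>2) < t - (m - 1)"
    by (intro real_less_lsqrt) auto
  then show "m - 1 + sqrt ((m - 1)\<^sup>2 + 4 * (c\<^sup>2 - 1) * m / c\<^sup>2) < t" by simp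
qed

subsection \<open>Modes of densities\<close>

text \<open>A nondegenerate interval is not a null set. It is used to pick points at which two
  versions of a density agree.\<close>

lemma AE_lborel_interval:
  fixes a b :: real
  assumes "AE x in lborel. P x" "a < b"
  obtains x where "a < x" "x < b" "P x"
proof (rule ccontr)
  assume "\<not> thesis"
  with that have "AE x in lborel. x \<notin> {a<..<b}"
    using assms(1) by (auto elim!: eventually_mono)
  then have "{a<..<b} \<in> null_sets lborel"
    by (subst (asm) AE_iff_null_sets[symmetric]) auto
  with \<open>a < b\<close> show False
    by (simp add: null_sets_def)
qed

text \<open>Any other version \<open>p\<close> of the density agrees with \<open>f\<close> almost
  everywhere. If \<open>p\<close> had its mode at some \<open>M'\<close> different from
  \<open>M\<close>, two points of agreement could be chosen where the strict order of the values of
  \<open>f\<close> contradicts the monotonicity of \<open>p\<close>.\<close>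

lemma unimodal_with_mode_iff:
  fixes f :: "real \<Rightarrow> real"
  assumes meas: "f \<in> borel_measurable borel"
    and zero: "\<And>x. x \<le> 0 \<Longrightarrow> f x = 0" and pos: "\<And>x. x > 0 \<Longrightarrow> f x > 0"
    and "M \<ge> 0"
    and incr: "\<And>x y. 0 < x \<Longrightarrow> x < y \<Longrightarrow> y < M \<Longrightarrow> f x < f y"
    and decr: "\<And>x y. M < x \<Longrightarrow> x < y \<Longrightarrow> f y < f x"
  shows "unimodal_with_mode (density lborel (\<lambda>x. ennreal (f x))) M' \<longleftrightarrow> M' = M"
proof
  have f0: "0 \<le> f x" for x
    by (cases "x > 0") (use zero pos[of x] in auto)
  assume "M' = M"
  have "mono_on {..<M} f"
  proof (rule mono_onI)
    fix x y assume "x \<in> {..<M}" "y \<in> {..<M}" "x \<le> y"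
    then show "f x \<le> f y"
      using incr[of x y] zero[of x] f0[of y] by (cases "x \<le> 0"; cases "x = y") auto
  qed
  moreover have "antimono_on {M<..} f"
  proof (rule monotone_onI)
    fix x y assume "x \<in> {M<..}" "y \<in> {M<..}" "x \<le> y"
    then show "f y \<le> f x" using decr[of x y] by (cases "x = y") auto
  qed
  ultimately show "unimodal_with_mode (density lborel (\<lambda>x. ennreal (f x))) M'"
    unfolding unimodal_with_mode_def \<open>M' = M\<close>
    using meas f0 by (intro exI[of _ f]) auto
next
  have f0: "0 \<le> f x" for x
    by (cases "x > 0") (use zero pos[of x] in auto)
  assume "unimodal_with_mode (density lborel (\<lambda>x. ennreal (f x))) M'"
  then obtain p where p: "p \<in> borel_measurable borel" "\<And>x. 0 \<le> p x"
      "density lborel (\<lambda>x. ennreal (f x)) = density lborel (\<lambda>x. ennreal (p x))"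
      "mono_on {..<M'} p" "antimono_on {M'<..} p"
    unfolding unimodal_with_mode_def by auto
  have "AE x in lborel. ennreal (f x) = ennreal (p x)"
    using p meas by (intro sigma_finite_measure.density_unique[OF sigma_finite_lborel]) auto
  then have ae: "AE x in lborel. f x = p x"
    using f0 p(2) by simp
  show "M' = M"
  proof (rule linorder_cases[of M' M])
    assume "M' < M"
    \<comment> \<open>For \<open>M > 0\<close> both points come from the positive part of the
      interval, where \<open>f\<close> increases strictly. For \<open>M = 0\<close> there is no such
      part, and the contradiction comes from the step of \<open>f\<close> from 0 on the negative
      axis to positive values.\<close>
    consider "M > 0" | "M = 0" using \<open>M \<ge> 0\<close> by linarith
    then obtain x y where xy: "M' < x" "x < y" "f x = p x" "f y = p y" "f x < f y"
    proof cases
      case 1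
      define v where "v = (max 0 M' + M) / 2"
      have v: "0 < v" "M' < v" "v < M" "max 0 M' < v"
        using \<open>M' < M\<close> 1 by (auto simp: v_def)
      obtain x where x: "max 0 M' < x" "x < v" "f x = p x" using AE_lborel_interval[OF ae v(4)] .
      obtain y where y: "v < y" "y < M" "f y = p y" using AE_lborel_interval[OF ae v(3)] .
      show ?thesis using x y incr[of x y] by (intro that[of x y]) auto
    next
      case 2
      with \<open>M' < M\<close> have "M' < 0" by simp
      then obtain x where x: "M' < x" "x < 0" "f x = p x" using AE_lborel_interval[OF ae] by blast
      obtain y where y: "0 < y" "f y = p y"
        using AE_lborel_interval[OF ae zero_less_one] by blast
      show ?thesis using x y zero[of x] pos[of y] by (intro that[of x y]) auto
    qed
    from xy p(5) have "p y \<le> p x" by (auto simp: monotone_on_def)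
    with xy show ?thesis by simp
  next
    assume "M < M'"
    define v where "v = (M + M') / 2"
    have v: "M < v" "v < M'" using \<open>M < M'\<close> by (auto simp: v_def)
    obtain x where x: "M < x" "x < v" "f x = p x" using AE_lborel_interval[OF ae v(1)] .
    obtain y where y: "v < y" "y < M'" "f y = p y" using AE_lborel_interval[OF ae v(2)] .
    from x y p(4) have "p x \<le> p y" by (auto simp: monotone_on_def)
    moreover have "f y < f x" using x y by (intro decr) auto
    ultimately show ?thesis using x y by simp
  qed
qed

section \<open>Monotonicity of the McKay density\<close>

definition mckay_kernel :: "real \<Rightarrow> real \<Rightarrow> real \<Rightarrow> real" where
  "mckay_kernel m c y = y powr (2 * m) * exp (- c * y) * bessel_clifford m (y\<^sup>2 / 4)"

lemma mckay_kernel_pos: "m > -1 \<Longrightarrow> y > 0 \<Longrightarrow> mckay_kernel m c y > 0"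
  by (simp add: mckay_kernel_def bessel_clifford_pos)

text \<open>For \<open>y > 0\<close> the kernel is \<open>2^m y^m exp(-c y) I_m(y)\<close>. Its
  logarithmic derivative is \<open>2 * m / y - c\<close> plus that of the
  \<open>bessel_clifford\<close> factor, and \<open>bessel_ratio\<close> is made so that this
  becomes \<open>bessel_ratio m y / y - c\<close>.\<close>

lemma DERIV_mckay_kernel:
  assumes "m > -1" "y > 0"
  shows "(mckay_kernel m c has_field_derivative
    mckay_kernel m c y * (bessel_ratio m y - c * y) / y) (at y)"
proof -
  define A B where "A = bessel_clifford m (y\<^sup>2 / 4)" and "B = bessel_clifford (m + 1) (y\<^sup>2 / 4)"
  have A: "A > 0" using assms unfolding A_def by (intro bessel_clifford_pos) auto
  have dA: "((\<lambda>y. bessel_clifford m (y\<^sup>2 / 4)) has_field_derivative B * (y / 2)) (at y)"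
    unfolding B_def by (auto intro!: derivative_eq_intros)
  have dp: "((\<lambda>y. y powr (2 * m)) has_field_derivative 2 * m / y * y powr (2 * m)) (at y)"
    using assms by (auto intro!: derivative_eq_intros simp: powr_diff)
  have de: "((\<lambda>y. exp (- c * y)) has_field_derivative - c * exp (- c * y)) (at y)"
    by (auto intro!: derivative_eq_intros)
  have "(mckay_kernel m c has_field_derivative
      (2 * m / y * y powr (2 * m) * exp (- c * y) + - c * exp (- c * y) * y powr (2 * m)) * A
      + B * (y / 2) * (y powr (2 * m) * exp (- c * y))) (at y)"
    unfolding mckay_kernel_def[abs_def] A_def
    by (rule DERIV_mult[OF DERIV_mult[OF dp de] dA])
  also have "(2 * m / y * y powr (2 * m) * exp (- c * y) + - c * exp (- c * y) * y powr (2 * m)) * A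
      + B * (y / 2) * (y powr (2 * m) * exp (- c * y))
      = y powr (2 * m) * exp (- c * y) * (2 * m / y * A - c * A + B * (y / 2))"
    by (simp add: algebra_simps)
  also have "2 * m / y * A - c * A + B * (y / 2) = A * (bessel_ratio m y - c * y) / y"
    unfolding bessel_ratio_def A_def[symmetric] B_def[symmetric] using A assms
    by (simp add: field_simps power2_eq_square)
  also have "y powr (2 * m) * exp (- c * y) * (A * (bessel_ratio m y - c * y) / y)
      = mckay_kernel m c y * (bessel_ratio m y - c * y) / y"
    by (simp add: mckay_kernel_def A_def)
  finally show ?thesis .
qed

lemma mckay_kernel_incr:
  assumes "m > -1" "0 < x" "x < y" "\<And>t. x < t \<Longrightarrow> t < y \<Longrightarrow> bessel_ratio m t > c * t"
  shows "mckay_kernel m c x < mckay_kernel m c y"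
proof (rule DERIV_pos_imp_increasing_open[OF \<open>x < y\<close>])
  fix t assume t: "x < t" "t < y"
  then have "mckay_kernel m c t * (bessel_ratio m t - c * t) / t > 0"
    using assms by (intro divide_pos_pos mult_pos_pos mckay_kernel_pos) auto
  then show "\<exists>d. (mckay_kernel m c has_field_derivative d) (at t) \<and> d > 0"
    using assms t by (blast intro: DERIV_mckay_kernel order.strict_trans)
next
  show "continuous_on {x..y} (mckay_kernel m c)"
    using assms by (intro continuous_at_imp_continuous_on ballI DERIV_isCont[OF DERIV_mckay_kernel]) auto
qed

lemma mckay_kernel_decr:
  assumes "m > -1" "0 < x" "x < y" "\<And>t. x < t \<Longrightarrow> t < y \<Longrightarrow> bessel_ratio m t < c * t"
  shows "mckay_kernel m c y < mckay_kernel m c x"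
proof (rule DERIV_neg_imp_decreasing_open[OF \<open>x < y\<close>])
  fix t assume t: "x < t" "t < y"
  then have "mckay_kernel m c t * (bessel_ratio m t - c * t) / t < 0"
    using assms by (intro divide_neg_pos mult_pos_neg mckay_kernel_pos) auto
  then show "\<exists>d. (mckay_kernel m c has_field_derivative d) (at t) \<and> d < 0"
    using assms t by (blast intro: DERIV_mckay_kernel order.strict_trans)
next
  show "continuous_on {x..y} (mckay_kernel m c)"
    using assms by (intro continuous_at_imp_continuous_on ballI DERIV_isCont[OF DERIV_mckay_kernel]) auto
qed

definition mckay1_coeff :: "real \<Rightarrow> real \<Rightarrow> real \<Rightarrow> real" where
  "mckay1_coeff m b c =
     sqrt pi * (c\<^sup>2 - 1) powr (m + 1/2) / (2 powr m * b powr (m + 1) * Gamma (m + 1/2))"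

lemma mckay1_coeff_pos:
  assumes "b > 0" "c > 1" "m > -1/2"
  shows "mckay1_coeff m b c > 0"
proof -
  have "c\<^sup>2 > 1" using assms by simp
  then have "c\<^sup>2 \<noteq> 1" by linarith
  then show ?thesis
    unfolding mckay1_coeff_def using assms by (auto intro!: divide_pos_pos mult_pos_pos Gamma_real_pos)
qed

lemma mckay1_density_eq:
  assumes "b > 0" "x > 0"
  shows "mckay1_density m b c x = mckay1_coeff m b c * x powr m * exp (- c * x / b) *
    ((x / b) powr m / 2 powr m * bessel_clifford m ((x / b)\<^sup>2 / 4))"
  unfolding mckay1_density_def mckay1_coeff_def
  using assms bessel_I_eq_bessel_clifford[of "x / b" m] by (simp add: powr_divide powr_mult)

text \<open>The parameter \<open>b\<close> only rescales the argument, so the mode is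
  \<open>b\<close> times the point where the kernel peaks.\<close>

lemma mckay1_density_eq_kernel:
  assumes "b > 0" "c > 1" "m > -1/2"
  obtains K where "K > 0" "\<And>x. x > 0 \<Longrightarrow> mckay1_density m b c x = K * mckay_kernel m c (x / b)"
proof -
  have N: "mckay1_coeff m b c > 0" using assms by (rule mckay1_coeff_pos)
  show ?thesis
  proof (rule that[of "mckay1_coeff m b c * b powr m / 2 powr m"])
    fix x :: real assume x: "x > 0"
    have 1: "x powr m = b powr m * (x / b) powr m"
      using assms x by (simp add: powr_mult[symmetric])
    have 2: "(x / b) powr (2 * m) = (x / b) powr m * (x / b) powr m"
      using powr_add[of "x / b" m m] by simp
    show "mckay1_density m b c x
        = mckay1_coeff m b c * b powr m / 2 powr m * mckay_kernel m c (x / b)"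
      unfolding mckay1_density_eq[OF \<open>b > 0\<close> x] mckay_kernel_def 1 2 by simp
  qed (use N assms in auto)
qed

lemma borel_measurable_mckay1_density:
  assumes "b > 0" "c > 1" "m > -1/2"
  shows "mckay1_density m b c \<in> borel_measurable borel"
proof -
  obtain K where K: "\<And>x. x > 0 \<Longrightarrow> mckay1_density m b c x = K * mckay_kernel m c (x / b)"
    using mckay1_density_eq_kernel[OF assms] by blast
  have "bessel_clifford m \<in> borel_measurable borel"
    by (rule borel_measurable_continuous_onI) (rule continuous_on_bessel_clifford)
  then have "(\<lambda>x. if x > 0 then K * mckay_kernel m c (x / b) else 0) \<in> borel_measurable borel"
    unfolding mckay_kernel_def by measurable
  also have "(\<lambda>x. if x > 0 then K * mckay_kernel m c (x / b) else 0) = mckay1_density m b c"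
    using K by (auto simp: mckay1_density_def)
  finally show ?thesis .
qed

text \<open>The sign of the ratio minus the line decides strict monotonicity on either side of
  \<open>b * M\<close>. Allowing \<open>M = 0\<close> covers the densities that decrease on the
  whole positive axis.\<close>

lemma unimodal_mckay1:
  assumes b: "b > 0" and c: "c > 1" and m: "m > -1/2" and "M \<ge> 0"
    and above: "\<And>y. 0 < y \<Longrightarrow> y < M \<Longrightarrow> bessel_ratio m y > c * y"
    and below: "\<And>y. y > M \<Longrightarrow> bessel_ratio m y < c * y"
  shows "unimodal_with_mode (mckay1 m b c) M' \<longleftrightarrow> M' = b * M"
proof -
  obtain K where K: "K > 0" "\<And>x. x > 0 \<Longrightarrow> mckay1_density m b c x = K * mckay_kernel m c (x / b)"
    using mckay1_density_eq_kernel[OF b c m] by blast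
  show ?thesis
    unfolding mckay1_def
  proof (rule unimodal_with_mode_iff)
    show "mckay1_density m b c \<in> borel_measurable borel"
      using b c m by (rule borel_measurable_mckay1_density)
    show "x \<le> 0 \<Longrightarrow> mckay1_density m b c x = 0" for x by (simp add: mckay1_density_def)
    show "x > 0 \<Longrightarrow> mckay1_density m b c x > 0" for x
      using K b m by (simp add: mckay_kernel_pos)
    show "0 \<le> b * M" using b \<open>M \<ge> 0\<close> by simp
  next
    fix x y assume xy: "0 < x" "x < y" "y < b * M"
    then have x': "0 < x / b" "x / b < y / b" "y / b < M"
      using b by (auto simp: field_simps)
    have "mckay_kernel m c (x / b) < mckay_kernel m c (y / b)"
      using m x' by (intro mckay_kernel_incr above) auto
    with K xy show "mckay1_density m b c x < mckay1_density m b c y" by simp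
  next
    fix x y assume xy: "b * M < x" "x < y"
    moreover have "0 \<le> b * M" using b \<open>M \<ge> 0\<close> by simp
    ultimately have "0 < x" "0 < y" by linarith+
    then have x': "0 < x / b" "x / b < y / b" "M < x / b"
      using b xy by (auto simp: field_simps)
    have "mckay_kernel m c (y / b) < mckay_kernel m c (x / b)"
      using m x' by (intro mckay_kernel_decr below) auto
    with K \<open>0 < x\<close> \<open>0 < y\<close> show "mckay1_density m b c y < mckay1_density m b c x" by simp
  qed
qed

subsection \<open>The mean\<close>

text \<open>The complex duplication formula restricted to the positive axis.\<close>

lemma Gamma_legendre_duplication_real:
  assumes "a > (0::real)"
  shows "Gamma a * Gamma (a + 1/2) = 2 powr (1 - 2 * a) * sqrt pi * Gamma (2 * a)"
proof -
  have "complex_of_real (Gamma a * Gamma (a + 1/2))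
      = Gamma (of_real a) * Gamma (of_real a + 1/2)"
    using Gamma_complex_of_real[of a] Gamma_complex_of_real[of "a + 1/2"] by simp
  also have "\<dots> = exp ((1 - 2 * of_real a) * of_real (ln 2)) * of_real (sqrt pi) * Gamma (2 * of_real a)"
  proof (rule Gamma_legendre_duplication)
    have "complex_of_real x \<notin> \<int>\<^sub>\<le>\<^sub>0" if "x > 0" for x
      using that by (auto simp: of_real_in_nonpos_Ints_iff)
    from this[of a] this[of "a + 1/2"] assms
    show "complex_of_real a \<notin> \<int>\<^sub>\<le>\<^sub>0" "complex_of_real a + 1/2 \<notin> \<int>\<^sub>\<le>\<^sub>0"
      by simp_all
  qed
  also have "\<dots> = of_real (2 powr (1 - 2 * a) * sqrt pi * Gamma (2 * a))"
    using Gamma_complex_of_real[of "2 * a"] exp_of_real[of "(1 - 2 * a) * ln 2", where 'a = complex]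
    by (simp add: powr_def)
  finally show ?thesis by (simp only: of_real_eq_iff)
qed

lemma nn_integral_powr_exp:
  fixes s l :: real
  assumes s: "s > 0" and l: "l > 0"
  shows "(\<integral>\<^sup>+x. ennreal (indicator {0<..} x * x powr (s - 1) * exp (- l * x)) \<partial>lborel)
    = ennreal (Gamma s / l powr s)"
proof -
  have "ennreal (Gamma s) = (\<integral>\<^sup>+t. ennreal (indicator {0..} t * t powr (s - 1) / exp t) \<partial>lborel)"
    by (rule Gamma_conv_nn_integral_real[OF s])
  also have "\<dots> = ennreal \<bar>l\<bar> * (\<integral>\<^sup>+x. ennreal (indicator {0..} (0 + l * x) *
      (0 + l * x) powr (s - 1) / exp (0 + l * x)) \<partial>lborel)"
    using l by (intro nn_integral_real_affine) auto
  \<comment> \<open>The integrands agree also at \<open>x = 0\<close>, where both vanish because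
    \<open>0 powr (s - 1) = 0\<close>.\<close>
  also have "(\<integral>\<^sup>+x. ennreal (indicator {0..} (0 + l * x) * (0 + l * x) powr (s - 1) / exp (0 + l * x)) \<partial>lborel)
      = (\<integral>\<^sup>+x. ennreal (l powr (s - 1)) * ennreal (indicator {0<..} x * x powr (s - 1) * exp (- l * x)) \<partial>lborel)"
    using l by (intro nn_integral_cong)
      (auto simp: indicator_def ennreal_mult[symmetric] powr_mult zero_le_mult_iff exp_minus field_simps)
  also have "\<dots> = ennreal (l powr (s - 1)) * (\<integral>\<^sup>+x. ennreal (indicator {0<..} x * x powr (s - 1) * exp (- l * x)) \<partial>lborel)"
    by (intro nn_integral_cmult) auto
  finally have *: "ennreal (Gamma s) = ennreal (l powr s) *
      (\<integral>\<^sup>+x. ennreal (indicator {0<..} x * x powr (s - 1) * exp (- l * x)) \<partial>lborel)" (is "_ = _ * ?I")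
    using l by (simp add: mult.assoc[symmetric] ennreal_mult'[symmetric] powr_diff)
  have "ennreal (Gamma s / l powr s) = ennreal (1 / l powr s) * ennreal (Gamma s)"
    using l s by (simp add: ennreal_mult'[symmetric])
  also have "\<dots> = ennreal (1 / l powr s) * ennreal (l powr s) * ?I"
    unfolding * by (simp add: mult.assoc)
  also have "ennreal (1 / l powr s) * ennreal (l powr s) = 1"
    using l by (simp add: ennreal_mult'[symmetric])
  finally show ?thesis by simp
qed

text \<open>The binomial series at \<open>- z\<close>: the signs in the generalized binomial
  coefficient of \<open>- a\<close> cancel those of the powers.\<close>

lemma pochhammer_powser:
  fixes a z :: real
  assumes "\<bar>z\<bar> < 1"
  shows "(\<lambda>k. pochhammer a k / fact k * z ^ k) sums (1 - z) powr (- a)"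
proof -
  have "(\<lambda>k. (- a gchoose k) * (- z) ^ k) sums (1 + - z) powr (- a)"
    using assms by (intro gen_binomial_real) auto
  moreover have "(- a gchoose k) * (- z) ^ k = pochhammer a k / fact k * z ^ k" for k
    by (simp add: gbinomial_pochhammer power_minus[of z])
  ultimately show ?thesis by simp
qed

text \<open>The Bessel series is integrated term by term against Gamma integrals. The duplication
  formula reduces the resulting Gamma quotients to Pochhammer symbols, and the binomial series at
  \<open>1 / c^2\<close> sums them.\<close>

lemma mckay1_mean:
  assumes b: "b > 0" and c: "c > 1" and m: "m > -1/2"
  shows "(\<integral>x. x \<partial>mckay1 m b c) = (2 * m + 1) * (b * c / (c\<^sup>2 - 1))"
proof -
  have meas: "mckay1_density m b c \<in> borel_measurable borel"
    using b c m by (rule borel_measurable_mckay1_density)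
  have c2: "c\<^sup>2 > 1" using c by simp
  then have c2': "c\<^sup>2 \<noteq> 1" by linarith
  define N where "N = mckay1_coeff m b c"
  have N: "N > 0" unfolding N_def using b c m by (rule mckay1_coeff_pos)
  define D where "D = N / (2 * b) powr m"
  have D: "D > 0" using N b by (simp add: D_def)
  define u where "u k = D * (rGamma (m + real k + 1) / fact k / (4 * b\<^sup>2) ^ k)" for k
  have rG: "rGamma (m + real k + 1) > 0" for k
    using m by (simp add: rGamma_inverse_Gamma Gamma_real_pos)
  have u: "u k \<ge> 0" for k using D b rG[of k] by (simp add: u_def)
  \<comment> \<open>The exponent is \<open>2 * m + 2 * k + 1\<close>, the last 1 being the factor
    \<open>x\<close> of the mean; it is written as \<open>s - 1\<close> to match the Gamma
    integral.\<close>
  define g where "g k x = indicator {0<..} x * x powr (2 * (m + real k + 1) - 1) * exp (- (c / b) * x)" for k x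
  have g: "g k x \<ge> 0" for k x by (simp add: g_def)
  have series: "(\<lambda>k. u k * g k x) sums (mckay1_density m b c x * x)" for x
  proof (cases "x > 0")
    case True
    have "(\<lambda>k. rGamma (m + real k + 1) / fact k * ((x / b)\<^sup>2 / 4) ^ k) sums bessel_clifford m ((x / b)\<^sup>2 / 4)"
      unfolding bessel_clifford_def by (rule summable_sums[OF summable_bessel_clifford])
    then have "(\<lambda>k. N * x powr m * exp (- c * x / b) * ((x / b) powr m / 2 powr m) * x *
        (rGamma (m + real k + 1) / fact k * ((x / b)\<^sup>2 / 4) ^ k)) sums
        (N * x powr m * exp (- c * x / b) * ((x / b) powr m / 2 powr m) * x * bessel_clifford m ((x / b)\<^sup>2 / 4))"
      by (rule sums_mult)
    also have "N * x powr m * exp (- c * x / b) * ((x / b) powr m / 2 powr m) * x * bessel_clifford m ((x / b)\<^sup>2 / 4)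
        = mckay1_density m b c x * x"
      unfolding mckay1_density_eq[OF b True] N_def by simp
    also have "(\<lambda>k. N * x powr m * exp (- c * x / b) * ((x / b) powr m / 2 powr m) * x *
        (rGamma (m + real k + 1) / fact k * ((x / b)\<^sup>2 / 4) ^ k)) = (\<lambda>k. u k * g k x)"
    proof
      fix k
      have "x powr (2 * (m + real k + 1) - 1) = x powr (m + m + real (2 * k) + 1)"
        by (simp add: algebra_simps)
      also have "\<dots> = x powr m * x powr m * x ^ (2 * k) * x"
        using True by (simp only: powr_add powr_realpow powr_one)
      finally have 1: "x powr (2 * (m + real k + 1) - 1) = x powr m * x powr m * (x\<^sup>2) ^ k * x"
        by (simp add: power_mult)
      have 2: "(x / b) powr m / 2 powr m = x powr m / (2 * b) powr m"
        using True b by (simp add: powr_divide powr_mult)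
      have 3: "((x / b)\<^sup>2 / 4) ^ k = (x\<^sup>2) ^ k / (4 * b\<^sup>2) ^ k"
        by (simp add: power_divide power_mult_distrib mult.commute)
      show "N * x powr m * exp (- c * x / b) * ((x / b) powr m / 2 powr m) * x *
          (rGamma (m + real k + 1) / fact k * ((x / b)\<^sup>2 / 4) ^ k) = u k * g k x"
        unfolding 2 3 u_def D_def g_def 1 using True by simp
    qed
    finally show ?thesis .
  qed (simp add: g_def mckay1_density_def)
  have nonneg: "0 \<le> mckay1_density m b c x * x" for x
    by (rule sums_le[OF _ sums_zero series]) (simp add: u g)
  have int_g: "(\<integral>\<^sup>+x. ennreal (u k * g k x) \<partial>lborel)
      = ennreal (u k * (Gamma (2 * (m + real k + 1)) / (c / b) powr (2 * (m + real k + 1))))" for k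
  proof -
    have "(\<integral>\<^sup>+x. ennreal (u k * g k x) \<partial>lborel) = (\<integral>\<^sup>+x. ennreal (u k) * ennreal (g k x) \<partial>lborel)"
      using u g by (simp add: ennreal_mult)
    also have "\<dots> = ennreal (u k) * (\<integral>\<^sup>+x. ennreal (g k x) \<partial>lborel)"
      unfolding g_def by (intro nn_integral_cmult) auto
    also have "(\<integral>\<^sup>+x. ennreal (g k x) \<partial>lborel) =
        ennreal (Gamma (2 * (m + real k + 1)) / (c / b) powr (2 * (m + real k + 1)))"
      unfolding g_def using m b c by (intro nn_integral_powr_exp) auto
    finally show ?thesis by (simp only: ennreal_mult'[OF u])
  qed
  \<comment> \<open>\<open>E\<close> collects all factors that do not depend on
    \<open>k\<close>.\<close>
  define E where "E = D * (b / c) powr (2 * (m + 1)) * 2 powr (2 * m + 1) / sqrt pi * Gamma (m + 3/2)"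
  have E: "E > 0" unfolding E_def using D b c m by (auto intro!: mult_pos_pos divide_pos_pos Gamma_real_pos)
  have term_eq: "u k * (Gamma (2 * (m + real k + 1)) / (c / b) powr (2 * (m + real k + 1)))
      = E * (pochhammer (m + 3/2) k / fact k * (1 / c\<^sup>2) ^ k)" for k
  proof -
    define a where "a = m + real k + 1"
    have a: "a > 0" using m by (simp add: a_def)
    \<comment> \<open>The factor \<open>Gamma a\<close> cancels \<open>rGamma a\<close> in
      \<open>u k\<close>, and the power of 2 supplies the \<open>4 ^ k\<close> that cancels the one
      in its denominator.\<close>
    have "Gamma (2 * a) = Gamma a * Gamma (a + 1/2) * 2 powr (2 * a - 1) / sqrt pi"
      unfolding Gamma_legendre_duplication_real[OF a]
      by (simp add: powr_add[symmetric])
    moreover have "Gamma (a + 1/2) = pochhammer (m + 3/2) k * Gamma (m + 3/2)"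
    proof -
      have "m + 3/2 \<notin> \<int>\<^sub>\<le>\<^sub>0" using m by (auto elim!: nonpos_Ints_cases)
      then have "pochhammer (m + 3/2) k = Gamma (m + 3/2 + real k) / Gamma (m + 3/2)"
        by (rule pochhammer_Gamma)
      moreover have "Gamma (m + 3/2) > 0" using m by (intro Gamma_real_pos) auto
      ultimately show ?thesis by (simp add: a_def add_ac)
    qed
    moreover have "2 powr (2 * a - 1) = 2 powr (2 * m + 1) * 4 ^ k"
    proof -
      have "2 powr (2 * a - 1) = 2 powr (2 * m + 1 + real (2 * k))" by (simp add: a_def algebra_simps)
      also have "\<dots> = 2 powr (2 * m + 1) * 2 ^ (2 * k)" by (simp only: powr_add powr_realpow)
      finally show ?thesis by (simp add: power_mult)
    qed
    moreover have "(c / b) powr (2 * a) = (c\<^sup>2 / b\<^sup>2) ^ k / (b / c) powr (2 * (m + 1))"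
    proof -
      have "(c / b) powr (2 * a) = (c / b) powr (2 * (m + 1) + real (2 * k))"
        by (simp add: a_def algebra_simps)
      also have "\<dots> = (c / b) powr (2 * (m + 1)) * ((c / b)\<^sup>2) ^ k"
        using b c by (simp add: powr_add powr_realpow power_mult del: of_nat_mult)
      also have "(c / b) powr (2 * (m + 1)) = 1 / (b / c) powr (2 * (m + 1))"
        using b c by (simp add: powr_divide)
      finally show ?thesis by (simp add: power_divide)
    qed
    moreover have "rGamma a * Gamma a = 1"
      using Gamma_real_pos[OF a] by (simp add: rGamma_inverse_Gamma)
    ultimately have "u k * (Gamma (2 * a) / (c / b) powr (2 * a))
      = D * ((rGamma a * Gamma a) * (pochhammer (m + 3/2) k * Gamma (m + 3/2)) / fact k / (4 * b\<^sup>2) ^ k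
         * (2 powr (2 * m + 1) * 4 ^ k) / sqrt pi / ((c\<^sup>2 / b\<^sup>2) ^ k / (b / c) powr (2 * (m + 1))))"
      unfolding u_def a_def[symmetric] by (simp add: mult_ac)
    also have "\<dots> = E * (pochhammer (m + 3/2) k / fact k * (1 / c\<^sup>2) ^ k)"
      unfolding \<open>rGamma a * Gamma a = 1\<close> E_def using b c
      by (simp add: power_mult_distrib power_divide mult_ac)
    finally show ?thesis by (simp add: a_def)
  qed
  have "(\<lambda>k. pochhammer (m + 3/2) k / fact k * (1 / c\<^sup>2) ^ k) sums (1 - 1 / c\<^sup>2) powr (- (m + 3/2))"
    using c2 by (intro pochhammer_powser) (auto simp: divide_less_eq)
  then have S: "(\<lambda>k. E * (pochhammer (m + 3/2) k / fact k * (1 / c\<^sup>2) ^ k)) sums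
      (E * (1 - 1 / c\<^sup>2) powr (- (m + 3/2)))"
    by (rule sums_mult)
  \<comment> \<open>The powers of \<open>q = c^2 - 1\<close>, with exponents \<open>m + 1/2\<close>
    and \<open>- (m + 3/2)\<close>, leave \<open>1 / q\<close>, while
    \<open>Gamma (m + 3/2) / Gamma (m + 1/2) = m + 1/2\<close> gives the factor
    \<open>2 * m + 1\<close>.\<close>
  have sum_value: "E * (1 - 1 / c\<^sup>2) powr (- (m + 3/2)) = (2 * m + 1) * (b * c / (c\<^sup>2 - 1))"
  proof -
    define q where "q = c\<^sup>2 - 1"
    have q: "q > 0" using c2 by (simp add: q_def)
    have 1: "(b / c) powr (2 * (m + 1)) = (b powr m * b)\<^sup>2 / (c powr m * c)\<^sup>2"
    proof -
      have "(b / c) powr (2 * (m + 1)) = (b / c) powr (m + 1) * (b / c) powr (m + 1)"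
        by (simp only: mult_2 powr_add)
      also have "(b / c) powr (m + 1) = (b powr m * b) / (c powr m * c)"
        using b c by (simp add: powr_divide powr_add)
      finally show ?thesis by (simp add: power2_eq_square)
    qed
    have 2: "2 powr (2 * m + 1) = (2 powr m)\<^sup>2 * (2::real)"
      by (simp only: powr_add mult_2[of m] power2_eq_square) simp
    have 3: "(1 - 1 / c\<^sup>2) powr (- (m + 3/2)) = (c powr m)\<^sup>2 * c ^ 3 / (q powr (m + 1/2) * q)"
    proof -
      have "1 - 1 / c\<^sup>2 = q / c\<^sup>2" using c by (simp add: q_def diff_divide_distrib)
      moreover have "(c\<^sup>2) powr (m + 3/2) = (c powr m)\<^sup>2 * c ^ 3"
      proof -
        have "(c\<^sup>2) powr (m + 3/2) = c powr (m + m + real 3)"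
          using c by (simp add: powr_powr flip: powr_numeral)
        also have "\<dots> = c powr m * c powr m * c ^ 3"
          using c by (simp only: powr_add powr_realpow)
        finally show ?thesis by (simp add: power2_eq_square)
      qed
      moreover have "q powr (m + 3/2) = q powr (m + 1/2) * q"
        using q powr_add[of q "m + 1/2" 1] by (simp add: add.assoc)
      ultimately show ?thesis using q c by (simp add: powr_minus powr_divide divide_simps)
    qed
    have 4: "Gamma (m + 3/2) = (m + 1/2) * Gamma (m + 1/2)"
    proof -
      have "m + 1/2 \<notin> \<int>\<^sub>\<le>\<^sub>0" using m by (auto elim!: nonpos_Ints_cases)
      then show ?thesis using Gamma_plus1[of "m + 1/2"] by (simp add: add.assoc)
    qed
    have "Gamma (m + 1/2) > 0" using m by (intro Gamma_real_pos) auto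
    then show ?thesis
      unfolding E_def D_def N_def mckay1_coeff_def q_def[symmetric] 1 2 3 4 using b c q
      by (simp add: powr_add powr_mult field_simps power2_eq_square power3_eq_cube)
  qed
  have "(\<integral>\<^sup>+x. ennreal (mckay1_density m b c x * x) \<partial>lborel)
      = (\<integral>\<^sup>+x. (\<Sum>k. ennreal (u k * g k x)) \<partial>lborel)"
    using series u g by (intro nn_integral_cong) (simp add: suminf_ennreal2 sums_iff)
  also have "\<dots> = (\<Sum>k. \<integral>\<^sup>+x. ennreal (u k * g k x) \<partial>lborel)"
    unfolding g_def by (intro nn_integral_suminf) auto
  also have "\<dots> = (\<Sum>k. ennreal (E * (pochhammer (m + 3/2) k / fact k * (1 / c\<^sup>2) ^ k)))"
    by (simp only: int_g term_eq)
  also have "\<dots> = ennreal (E * (1 - 1 / c\<^sup>2) powr (- (m + 3/2)))"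
    using S E m by (subst suminf_ennreal2)
      (auto simp: sums_iff intro!: mult_nonneg_nonneg divide_nonneg_pos pochhammer_nonneg)
  finally have "has_bochner_integral lborel (\<lambda>x. mckay1_density m b c x * x)
      (E * (1 - 1 / c\<^sup>2) powr (- (m + 3/2)))"
    using E meas nonneg by (intro has_bochner_integral_nn_integral) auto
  then have "(\<integral>x. mckay1_density m b c x * x \<partial>lborel) = (2 * m + 1) * (b * c / (c\<^sup>2 - 1))"
    unfolding sum_value by (rule has_bochner_integral_integral_eq)
  moreover have "0 \<le> mckay1_density m b c x" for x
  proof (cases "x > 0")
    case True
    with nonneg[of x] show ?thesis by (simp add: zero_le_mult_iff)
  qed (simp add: mckay1_density_def)
  ultimately show ?thesis
    unfolding mckay1_def using meas by (subst integral_density) auto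
qed

subsection \<open>Bounds and their sharpness\<close>

lemma distr_eq_mckay1:
  assumes "distributed S lborel X (\<lambda>x. ennreal (mckay1_density m b c x))"
  shows "distr S lborel X = mckay1 m b c"
    and "(\<integral>\<omega>. X \<omega> \<partial>S) = (\<integral>x. x \<partial>mckay1 m b c)"
proof -
  show eq: "distr S lborel X = mckay1 m b c"
    using assms by (simp add: distributed_def mckay1_def)
  have "X \<in> measurable S lborel" using assms by (simp add: distributed_def)
  then show "(\<integral>\<omega>. X \<omega> \<partial>S) = (\<integral>x. x \<partial>mckay1 m b c)"
    unfolding eq[symmetric] by (subst integral_distr) auto
qed

text \<open>Here the ratio stays below the line, so the crossing point is replaced by 0.\<close>

lemma mckay1_mode_nonpos:
  assumes "b > 0" "c > 1" "m > -1/2" "m \<le> 0"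
  shows "unimodal_with_mode (mckay1 m b c) M \<longleftrightarrow> M = 0"
  using unimodal_mckay1[OF assms(1-3), of 0 M] bessel_ratio_below_line[OF assms(3,4,2)] by simp

lemma mckay1_mode_pos:
  assumes b: "b > 0" and c: "c > 1" and m: "m > 0"
  defines "K \<equiv> b * c / (c\<^sup>2 - 1)"
  obtains M where "\<And>M'. unimodal_with_mode (mckay1 m b c) M' \<longleftrightarrow> M' = M"
    "(2 * m - 1) * K < M" "M < K * (m - 1/2 + sqrt ((m + 1/2)\<^sup>2 - 2 * m / c\<^sup>2))"
    "K * (m - 1 + sqrt ((m - 1)\<^sup>2 + 4 * (c\<^sup>2 - 1) * m / c\<^sup>2)) < M"
proof -
  have c2: "c\<^sup>2 > 1" using c by simp
  then have "c\<^sup>2 - 1 \<noteq> 0" by linarith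
  from c2 have K: "K > 0" unfolding K_def using b c by (intro divide_pos_pos) auto
  obtain y where y: "y > 0" "bessel_ratio m y = c * y"
    "\<And>t. 0 < t \<Longrightarrow> t < y \<Longrightarrow> bessel_ratio m t > c * t"
    "\<And>t. t > y \<Longrightarrow> bessel_ratio m t < c * t"
    using bessel_ratio_crossing[OF m c] by metis
  define t where "t = (c\<^sup>2 - 1) * y / c"
  \<comment> \<open>Thus \<open>t\<close> is the mode measured in units of \<open>K\<close>, and the
    bounds on \<open>t\<close> carry over by scaling.\<close>
  have yt: "b * y = K * t" using c \<open>c\<^sup>2 - 1 \<noteq> 0\<close> by (simp add: K_def t_def)
  note bounds = crossing_bounds[OF m c y(1,2), folded t_def]
  show ?thesis
  proof (rule that[of "b * y"])
    show "unimodal_with_mode (mckay1 m b c) M' \<longleftrightarrow> M' = b * y" for M'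
      using b c m y by (intro unimodal_mckay1) auto
  qed (unfold yt, insert K bounds, auto simp: mult.commute[of K] intro!: mult_strict_right_mono)
qed

text \<open>Replacing the root by \<open>m + 1/2\<close> turns the inner bounds into the outermost
  upper bound for the mode and the outermost lower bound for the mean minus the mode.\<close>

lemma sqrt_bracket_less:
  fixes m c :: real
  assumes "m > 0" "c > 1"
  shows "sqrt ((m + 1/2)\<^sup>2 - 2 * m / c\<^sup>2) < m + 1/2"
  using assms by (intro real_less_lsqrt) auto

section \<open>Sharpness of the bounds for the mode\<close>

text \<open>The upper bound for the mode divided by \<open>b c / (c\<^sup>2 - 1)\<close> tends to \<open>2 m - 1\<close> as \<open>c\<close> tends to \<open>1\<close>, for \<open>m \<ge> 1/2\<close>.\<close>

lemma mckay1_mode_less: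
  fixes a :: real
  assumes "a < 1"
  obtains c M where "c > 1" "unimodal_with_mode (mckay1 1 1 c) M" "M < (2 - a) * (c / (c\<^sup>2 - 1))"
proof -
  \<comment> \<open>Here \<open>t = 1 - 1 / c^2\<close>. At \<open>m = 1\<close> the radicand is
    \<open>1/4 + 2 * t\<close>, and it must not exceed
    \<open>(3/2 - a)^2 = 1/4 + (1 - a) * (2 - a)\<close>; as \<open>2 - a > 1\<close>, the condition
    \<open>2 * t \<le> 1 - a\<close> suffices. The cap 1/2 keeps \<open>1 - t\<close>
    positive.\<close>
  define t where "t = min (1/2) ((1 - a) / 2)"
  have "t \<le> (1 - a) / 2" unfolding t_def by (rule min.cobounded2)
  moreover have "0 < t" "t \<le> 1/2" using assms by (auto simp: t_def)
  ultimately have t: "0 < t" "t < 1" "2 * t \<le> 1 - a" by auto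
  define c where "c = 1 / sqrt (1 - t)"
  have "sqrt (1 - t) < 1" "0 < sqrt (1 - t)" using t by auto
  then have c: "c > 1" by (simp add: c_def)
  have c2: "2 / c\<^sup>2 = 2 - 2 * t" using t by (simp add: c_def power_divide)
  have cc: "c\<^sup>2 > 1" using c by simp
  obtain M where M: "unimodal_with_mode (mckay1 1 1 c) M"
      "M < c / (c\<^sup>2 - 1) * (1/2 + sqrt ((1 + 1/2)\<^sup>2 - 2 / c\<^sup>2))"
    using mckay1_mode_pos[of 1 c 1] c by auto
  have "sqrt ((1 + 1/2)\<^sup>2 - 2 / c\<^sup>2) \<le> 3/2 - a"
  proof (rule real_le_lsqrt)
    have "1 - a \<le> (1 - a) * (2 - a)" using assms mult_left_mono[of 1 "2 - a" "1 - a"] by simp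
    then show "(1 + 1/2)\<^sup>2 - 2 / c\<^sup>2 \<le> (3/2 - a)\<^sup>2"
      unfolding c2 using t by (simp add: power2_eq_square algebra_simps)
  qed (use assms in auto)
  then have "c / (c\<^sup>2 - 1) * (1/2 + sqrt ((1 + 1/2)\<^sup>2 - 2 / c\<^sup>2)) \<le> c / (c\<^sup>2 - 1) * (2 - a)"
    using c cc by (intro mult_left_mono divide_nonneg_pos) auto
  with M(2) have "M < (2 - a) * (c / (c\<^sup>2 - 1))" by (simp add: mult.commute)
  with c M(1) show ?thesis by (rule that)
qed

text \<open>At \<open>m = 1\<close> the last lower bound for the mode has the bracket
  \<open>sqrt (4 * (c^2 - 1) / c^2)\<close>, which tends to 2 as \<open>c\<close> grows.\<close>

lemma mckay1_mode_greater:
  fixes a :: real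
  assumes "a > 0"
  obtains c M where "c > 1" "unimodal_with_mode (mckay1 1 1 c) M" "(2 - a) * (c / (c\<^sup>2 - 1)) < M"
proof -
  \<comment> \<open>The cap at 1 ensures \<open>2 / e > 1\<close>. The choice
    \<open>c^2 = 2 / e\<close> makes the radicand \<open>4 - 2 * e\<close>, which is at least
    \<open>(2 - e)^2\<close> because \<open>e \<le> 2\<close>.\<close>
  define e where "e = min a 1"
  have e: "0 < e" "e \<le> 1" "e \<le> a" using assms by (auto simp: e_def)
  define c where "c = sqrt (2 / e)"
  have c: "c > 1" using e by (auto simp: c_def field_simps)
  have c2: "c\<^sup>2 = 2 / e" using e by (simp add: c_def)
  have cc: "c\<^sup>2 > 1" using c by simp
  obtain M where M: "unimodal_with_mode (mckay1 1 1 c) M"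
      "c / (c\<^sup>2 - 1) * sqrt (4 * (c\<^sup>2 - 1) / c\<^sup>2) < M"
    using mckay1_mode_pos[of 1 c 1] c by auto
  have "2 - e \<le> sqrt (4 * (c\<^sup>2 - 1) / c\<^sup>2)"
  proof (rule real_le_rsqrt)
    have "4 * (c\<^sup>2 - 1) / c\<^sup>2 = 4 - 2 * e" unfolding c2 using e by (simp add: field_simps)
    moreover have "e * e \<le> e * 2" using e by (intro mult_left_mono) auto
    ultimately show "(2 - e)\<^sup>2 \<le> 4 * (c\<^sup>2 - 1) / c\<^sup>2"
      by (simp add: power2_eq_square algebra_simps)
  qed
  then have "2 - a \<le> sqrt (4 * (c\<^sup>2 - 1) / c\<^sup>2)" using e by linarith
  then have "c / (c\<^sup>2 - 1) * (2 - a) \<le> c / (c\<^sup>2 - 1) * sqrt (4 * (c\<^sup>2 - 1) / c\<^sup>2)"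
    using c cc by (intro mult_left_mono divide_nonneg_pos) auto
  with M(2) have "(2 - a) * (c / (c\<^sup>2 - 1)) < M" by (simp add: mult.commute)
  with c M(1) show ?thesis by (rule that)
qed

section \<open>The mode and its distance from the mean\<close>

lemma mckay1_mode_and_mean_bounds:
  fixes m b c :: real and S :: "'a measure" and X :: "'a \<Rightarrow> real"
  assumes b: "b > 0" and c: "c > 1" and m: "m > -1/2"
    and X: "distributed S lborel X (\<lambda>x. ennreal (mckay1_density m b c x))"
  shows "(\<exists>!M. unimodal_with_mode (distr S lborel X) M) \<and>
      (\<forall>M. unimodal_with_mode (distr S lborel X) M \<longrightarrow>
        (m \<le> 0 \<longrightarrow> M = 0) \<and>
        (m > 0 \<longrightarrow>
          ((2 * m - 1) * b * c / (c\<^sup>2 - 1) < M \<and>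
           M < b * c / (c\<^sup>2 - 1) * (m - 1/2 + sqrt ((m + 1/2)\<^sup>2 - 2 * m / c\<^sup>2)) \<and>
           b * c / (c\<^sup>2 - 1) * (m - 1/2 + sqrt ((m + 1/2)\<^sup>2 - 2 * m / c\<^sup>2))
             < 2 * m * b * c / (c\<^sup>2 - 1)) \<and>
          (b * c / (c\<^sup>2 - 1)
             < b * c / (c\<^sup>2 - 1) * (3/2 + m - sqrt ((m + 1/2)\<^sup>2 - 2 * m / c\<^sup>2)) \<and>
           b * c / (c\<^sup>2 - 1) * (3/2 + m - sqrt ((m + 1/2)\<^sup>2 - 2 * m / c\<^sup>2))
             < (\<integral>\<omega>. X \<omega> \<partial>S) - M \<and>
           (\<integral>\<omega>. X \<omega> \<partial>S) - M < 2 * b * c / (c\<^sup>2 - 1)) \<and>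
          M > b * c / (c\<^sup>2 - 1) * (m - 1 + sqrt ((m - 1)\<^sup>2 + 4 * (c\<^sup>2 - 1) * m / c\<^sup>2))))"
proof (cases "m \<le> 0")
  case True
  then show ?thesis
    unfolding distr_eq_mckay1(1)[OF X] mckay1_mode_nonpos[OF b c m True] by simp
next
  case False
  then have m: "m > 0" by simp
  define K where "K = b * c / (c\<^sup>2 - 1)"
  define s where "s = sqrt ((m + 1/2)\<^sup>2 - 2 * m / c\<^sup>2)"
  have "c\<^sup>2 > 1" using c by simp
  then have K: "K > 0" unfolding K_def using b c by (intro divide_pos_pos) auto
  obtain M where M: "\<And>M'. unimodal_with_mode (mckay1 m b c) M' \<longleftrightarrow> M' = M"
      "(2 * m - 1) * K < M" "M < K * (m - 1/2 + s)"
      "K * (m - 1 + sqrt ((m - 1)\<^sup>2 + 4 * (c\<^sup>2 - 1) * m / c\<^sup>2)) < M"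
    using mckay1_mode_pos[OF b c m] unfolding K_def s_def by blast
  have s: "K * s < K * (m + 1/2)"
    unfolding s_def using K sqrt_bracket_less[OF m c] by (rule mult_strict_left_mono[rotated])
  have EX: "(\<integral>\<omega>. X \<omega> \<partial>S) = (2 * m + 1) * K"
    unfolding K_def distr_eq_mckay1(2)[OF X] using b c m by (intro mckay1_mean) auto
  have K_simps: "(2 * m - 1) * b * c / (c\<^sup>2 - 1) = (2 * m - 1) * K"
      "2 * m * b * c / (c\<^sup>2 - 1) = 2 * m * K" "2 * b * c / (c\<^sup>2 - 1) = 2 * K"
    by (simp_all add: K_def mult.assoc)
  \<comment> \<open>After rewriting, being a mode is an equation with \<open>M\<close>, and the mean
    is \<open>(2 * m + 1) * K\<close>. Subtracting the bounds for \<open>M\<close> from the mean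
    gives those for the difference.\<close>
  show ?thesis
    unfolding distr_eq_mckay1(1)[OF X] M(1) K_simps K_def[symmetric] s_def[symmetric] EX
    using m M(2-4) s by (auto simp: algebra_simps)
qed

theorem theorem2p9:
  shows "(\<forall>(m::real) (b::real) (c::real) (S :: 'a measure) (X :: 'a \<Rightarrow> real).
      b > 0 \<and> c > 1 \<and> m > -1/2 \<and> prob_space S \<and>
      distributed S lborel X (\<lambda>x. ennreal (mckay1_density m b c x)) \<longrightarrow>
      (\<exists>!M. unimodal_with_mode (distr S lborel X) M) \<and>
      (\<forall>M. unimodal_with_mode (distr S lborel X) M \<longrightarrow>
        (m \<le> 0 \<longrightarrow> M = 0) \<and>
        (m > 0 \<longrightarrow>
          ((2 * m - 1) * b * c / (c\<^sup>2 - 1) < M \<and>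
           M < b * c / (c\<^sup>2 - 1) * (m - 1/2 + sqrt ((m + 1/2)\<^sup>2 - 2 * m / c\<^sup>2)) \<and>
           b * c / (c\<^sup>2 - 1) * (m - 1/2 + sqrt ((m + 1/2)\<^sup>2 - 2 * m / c\<^sup>2))
             < 2 * m * b * c / (c\<^sup>2 - 1)) \<and>
          (b * c / (c\<^sup>2 - 1)
             < b * c / (c\<^sup>2 - 1) * (3/2 + m - sqrt ((m + 1/2)\<^sup>2 - 2 * m / c\<^sup>2)) \<and>
           b * c / (c\<^sup>2 - 1) * (3/2 + m - sqrt ((m + 1/2)\<^sup>2 - 2 * m / c\<^sup>2))
             < (\<integral>\<omega>. X \<omega> \<partial>S) - M \<and>
           (\<integral>\<omega>. X \<omega> \<partial>S) - M < 2 * b * c / (c\<^sup>2 - 1)) \<and>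
          M > b * c / (c\<^sup>2 - 1) * (m - 1 + sqrt ((m - 1)\<^sup>2 + 4 * (c\<^sup>2 - 1) * m / c\<^sup>2)))))
    \<and> (\<forall>a::real. a < 1 \<longrightarrow>
        \<not> (\<forall>m b c M. m > 0 \<and> b > 0 \<and> c > 1 \<and> unimodal_with_mode (mckay1 m b c) M \<longrightarrow>
              (2 * m - a) * b * c / (c\<^sup>2 - 1) \<le> M))
    \<and> (\<forall>a::real. a > 0 \<longrightarrow>
        \<not> (\<forall>m b c M. m > 0 \<and> b > 0 \<and> c > 1 \<and> unimodal_with_mode (mckay1 m b c) M \<longrightarrow>
              M \<le> (2 * m - a) * b * c / (c\<^sup>2 - 1)))
    \<and> (\<forall>\<kappa>::real. \<kappa> > 1 \<longrightarrow>
        \<not> (\<forall>m b c M. m > 0 \<and> b > 0 \<and> c > 1 \<and> unimodal_with_mode (mckay1 m b c) M \<longrightarrow>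
              \<kappa> * b * c / (c\<^sup>2 - 1) \<le> (\<integral>x. x \<partial>(mckay1 m b c)) - M))
    \<and> (\<forall>\<kappa>::real. \<kappa> < 2 \<longrightarrow>
        \<not> (\<forall>m b c M. m > 0 \<and> b > 0 \<and> c > 1 \<and> unimodal_with_mode (mckay1 m b c) M \<longrightarrow>
              (\<integral>x. x \<partial>(mckay1 m b c)) - M \<le> \<kappa> * b * c / (c\<^sup>2 - 1)))"
proof -
  have mean: "(\<integral>x. x \<partial>mckay1 1 1 c) = 3 * (c / (c\<^sup>2 - 1))" if "c > 1" for c
    using mckay1_mean[of 1 c 1] that by simp
  have sharp: "\<exists>c M. c > 1 \<and> unimodal_with_mode (mckay1 1 1 c) M \<and>
      M < (2 - a) * (c / (c\<^sup>2 - 1))" if "a < 1" for a :: real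
    using mckay1_mode_less[OF that] by metis
  have sharp': "\<exists>c M. c > 1 \<and> unimodal_with_mode (mckay1 1 1 c) M \<and>
      (2 - a) * (c / (c\<^sup>2 - 1)) < M" if "a > 0" for a :: real
    using mckay1_mode_greater[OF that] by metis
  show ?thesis
  proof (intro conjI)
    show "\<forall>a::real. a < 1 \<longrightarrow>
        \<not> (\<forall>m b c M. m > 0 \<and> b > 0 \<and> c > 1 \<and> unimodal_with_mode (mckay1 m b c) M \<longrightarrow>
              (2 * m - a) * b * c / (c\<^sup>2 - 1) \<le> M)"
    proof (intro allI impI notI)
      fix a :: real
      assume "a < 1" and H: "\<forall>m b c M. m > 0 \<and> b > 0 \<and> c > 1 \<and>
        unimodal_with_mode (mckay1 m b c) M \<longrightarrow> (2 * m - a) * b * c / (c\<^sup>2 - 1) \<le> M"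
      obtain c M where "c > 1" "unimodal_with_mode (mckay1 1 1 c) M" "M < (2 - a) * (c / (c\<^sup>2 - 1))"
        using sharp[OF \<open>a < 1\<close>] by blast
      with H[rule_format, of 1 1 c M] show False by simp
    qed
    show "\<forall>a::real. a > 0 \<longrightarrow>
        \<not> (\<forall>m b c M. m > 0 \<and> b > 0 \<and> c > 1 \<and> unimodal_with_mode (mckay1 m b c) M \<longrightarrow>
              M \<le> (2 * m - a) * b * c / (c\<^sup>2 - 1))"
    proof (intro allI impI notI)
      fix a :: real
      assume "a > 0" and H: "\<forall>m b c M. m > 0 \<and> b > 0 \<and> c > 1 \<and>
        unimodal_with_mode (mckay1 m b c) M \<longrightarrow> M \<le> (2 * m - a) * b * c / (c\<^sup>2 - 1)"
      obtain c M where "c > 1" "unimodal_with_mode (mckay1 1 1 c) M" "(2 - a) * (c / (c\<^sup>2 - 1)) < M"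
        using sharp'[OF \<open>a > 0\<close>] by blast
      with H[rule_format, of 1 1 c M] show False by simp
    qed
    show "\<forall>\<kappa>::real. \<kappa> > 1 \<longrightarrow>
        \<not> (\<forall>m b c M. m > 0 \<and> b > 0 \<and> c > 1 \<and> unimodal_with_mode (mckay1 m b c) M \<longrightarrow>
              \<kappa> * b * c / (c\<^sup>2 - 1) \<le> (\<integral>x. x \<partial>(mckay1 m b c)) - M)"
    proof (intro allI impI notI)
      fix \<kappa> :: real
      assume "\<kappa> > 1" and H: "\<forall>m b c M. m > 0 \<and> b > 0 \<and> c > 1 \<and>
        unimodal_with_mode (mckay1 m b c) M \<longrightarrow>
          \<kappa> * b * c / (c\<^sup>2 - 1) \<le> (\<integral>x. x \<partial>(mckay1 m b c)) - M"
      \<comment> \<open>The mean is \<open>3 * (c / (c^2 - 1))\<close>, so a lower bound with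
        \<kappa> for the difference is an upper bound for the mode with
        \<open>3 - \<kappa> = 2 - (\<kappa> - 1)\<close>, which is the case
        \<open>a = \<kappa> - 1 > 0\<close>.\<close>
      then obtain c M where M: "c > 1" "unimodal_with_mode (mckay1 1 1 c) M"
          "(2 - (\<kappa> - 1)) * (c / (c\<^sup>2 - 1)) < M"
        using sharp'[of "\<kappa> - 1"] by auto
      then have "\<kappa> * (c / (c\<^sup>2 - 1)) \<le> 3 * (c / (c\<^sup>2 - 1)) - M"
        using H[rule_format, of 1 1 c M] mean by simp
      with M(3) show False by (simp only: left_diff_distrib)
    qed
    show "\<forall>\<kappa>::real. \<kappa> < 2 \<longrightarrow>
        \<not> (\<forall>m b c M. m > 0 \<and> b > 0 \<and> c > 1 \<and> unimodal_with_mode (mckay1 m b c) M \<longrightarrow>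
              (\<integral>x. x \<partial>(mckay1 m b c)) - M \<le> \<kappa> * b * c / (c\<^sup>2 - 1))"
    proof (intro allI impI notI)
      fix \<kappa> :: real
      assume "\<kappa> < 2" and H: "\<forall>m b c M. m > 0 \<and> b > 0 \<and> c > 1 \<and>
        unimodal_with_mode (mckay1 m b c) M \<longrightarrow>
          (\<integral>x. x \<partial>(mckay1 m b c)) - M \<le> \<kappa> * b * c / (c\<^sup>2 - 1)"
      \<comment> \<open>By the same correspondence, now with \<open>a = \<kappa> - 1 < 1\<close> and
        a lower bound for the mode.\<close>
      then obtain c M where M: "c > 1" "unimodal_with_mode (mckay1 1 1 c) M"
          "M < (2 - (\<kappa> - 1)) * (c / (c\<^sup>2 - 1))"
        using sharp[of "\<kappa> - 1"] by auto
      then have "3 * (c / (c\<^sup>2 - 1)) - M \<le> \<kappa> * (c / (c\<^sup>2 - 1))"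
        using H[rule_format, of 1 1 c M] mean by simp
      with M(3) show False by (simp only: left_diff_distrib)
    qed
  qed (use mckay1_mode_and_mean_bounds in blast)
qed

end
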